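(* Let $n\ge 1$ and let $A$ and $B$ be Hermitian (complex) $n\times n$ matrices such that $A$ is positive definite. Then $\iota(\eta(zA,-B))=\iota(\eta(zI,-B))$ (and $\iota(\eta(zI,-B))=\iota(\det(zI-B))$), where $I$ is the $n\times n$ identity matrix.
   Context: For an $n\times n$ matrix $A$ and $\mathcal{S}\subseteq\{1,\ldots,n\}$, $A[\mathcal{S}]$ denotes the $|\mathcal{S}|\times|\mathcal{S}|$ principal submatrix of $A$ with rows and columns indexed by $\mathcal{S}$, $\mathcal{S}'$ denotes the complement of $\mathcal{S}$ in $\{1,\ldots,n\}$, and by convention $\det(A[\emptyset])=1$. For $n\times n$ matrices $A,B$ define $$\eta(A,B)=\sum_{\mathcal{S}\subseteq\{1,\ldots,n\}}\det(A[\mathcal{S}])\det(B[\mathcal{S}']).$$ A nonzero univariate real polynomial is hyperbolic if all its zeros are real. For a hyperbolic polynomial $p(z)$ let $\iota_+(p(z))$, $\iota_-(p(z))$, $\iota_0(p(z))$ be the numbers (counting multiplicities) of positive, negative and zero roots of $p$, and set $\iota(p(z))=(\iota_+(p(z)),\iota_0(p(z)),\iota_-(p(z)))$. (That $\eta(zA,-B)$ is hyperbolic for $A$ positive definite and $B$ Hermitian is part of what makes the statement meaningful.) *)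

theory Defs
  imports
    "Jordan_Normal_Form.Schur_Decomposition"
    "Jordan_Normal_Form.DL_Submatrix"
    "HOL-Computational_Algebra.Fundamental_Theorem_Algebra"
begin

definition hermitian :: "complex mat \<Rightarrow> bool" where
  "hermitian A \<longleftrightarrow> mat_adjoint A = A"

(* In the order on complex used here, 0 < c means that c is real and positive. *)
definition pos_definite :: "complex mat \<Rightarrow> bool" where
  "pos_definite A \<longleftrightarrow> hermitian A \<and>
     (\<forall>v \<in> carrier_vec (dim_row A). v \<noteq> 0\<^sub>v (dim_row A) \<longrightarrow> 0 < (A *\<^sub>v v) \<bullet>c v)"

(* Index sets are subsets of {0..<n}. The library gives a 0 x 0 matrix determinant 1. *)
definition eta :: "'a :: comm_ring_1 mat \<Rightarrow> 'a mat \<Rightarrow> 'a" where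
  "eta A B = (\<Sum>S \<in> Pow {0..<dim_row A}.
     det (submatrix A S S) * det (submatrix B ({0..<dim_row A} - S) ({0..<dim_row A} - S)))"

definition const_mat :: "complex mat \<Rightarrow> complex poly mat" where
  "const_mat M = map_mat (\<lambda>c. [:c:]) M"

definition z_times :: "complex mat \<Rightarrow> complex poly mat" where
  "z_times M = [:0, 1:] \<cdot>\<^sub>m const_mat M"

(* Real polynomials are the complex polynomials with real coefficients, since the
   determinants that occur are taken over the complex polynomials. *)
definition hyperbolic :: "complex poly \<Rightarrow> bool" where
  "hyperbolic p \<longleftrightarrow> p \<noteq> 0 \<and> (\<forall>i. coeff p i \<in> \<real>) \<and> (\<forall>w. poly p w = 0 \<longrightarrow> w \<in> \<real>)"

(* proots p is the multiset of roots of p, with multiplicities. *)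
definition iota_pos :: "complex poly \<Rightarrow> nat" where
  "iota_pos p = size (filter_mset (\<lambda>w. w \<in> \<real> \<and> Re w > 0) (proots p))"

definition iota_neg :: "complex poly \<Rightarrow> nat" where
  "iota_neg p = size (filter_mset (\<lambda>w. w \<in> \<real> \<and> Re w < 0) (proots p))"

definition iota_zero :: "complex poly \<Rightarrow> nat" where
  "iota_zero p = count (proots p) 0"

definition iota :: "complex poly \<Rightarrow> nat \<times> nat \<times> nat" where
  "iota p = (iota_pos p, iota_zero p, iota_neg p)"

end

theory Submission
  imports Defs
begin

text \<open>Averaging \<open>det (D P D + C)\<close> over all diagonal sign matrices \<open>D\<close> gives \<open>\<eta>(P, C)\<close>. Switching the
  sign of one diagonal entry at a time and using that a half-plane is convex, one sees that the
  average does not vanish when the imaginary part of \<open>P\<close> is positive definite and that of \<open>C\<close> is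
  positive semidefinite; for \<open>P = z A\<close> and \<open>C = - B\<close> this is hyperbolicity of \<open>\<eta>(z A, - B)\<close>. Its
  order of vanishing at \<open>0\<close> is the nullity of \<open>B\<close>, since by Sylvester's law the lowest terms of
  all the summands have the same sign. Along the segment from \<open>A\<close> to the identity, degree,
  real-rootedness and the multiplicity of \<open>0\<close> are therefore constant, and as the roots move
  continuously none of them can change sign.\<close>

section \<open>Sign averages of determinants\<close>

text \<open>\<open>eta\<close> depends on the coordinates: a common congruence of \<open>A\<close>
  and \<open>B\<close> does not multiply it by a constant, so the case of general \<open>A\<close>
  cannot be transformed into \<open>A = I\<close>. The summands \<open>det (z D A D - B)\<close> of
  the sign average do behave well under congruence, but real-rootedness of each is not enough, since
  a sum of real-rooted polynomials may have nonreal roots. This is why nonvanishing is carried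
  through partial averages, for a class of pairs that is stable under cutting off one index. For the
  multiplicity of 0, one congruence that diagonalizes \<open>B\<close> is applied to all summands at
  once; it leaves different matrices in place of \<open>D A D\<close>, but all of them are positive
  definite, and only the signs of their principal minors enter the lowest terms. These minors do not
  show how the remaining roots split into positive and negative ones, hence the deformation of
  \<open>A\<close>.\<close>

definition fdet :: "nat \<Rightarrow> (nat \<Rightarrow> nat \<Rightarrow> 'a :: comm_ring_1) \<Rightarrow> 'a" where
  "fdet n F = det (mat n n (\<lambda>(i, j). F i j))"

lemma fdet_leibniz:
  "fdet n F = (\<Sum>p | p permutes {0..<n}. signof p * (\<Prod>i = 0..<n. F i (p i)))"
  unfolding fdet_def
  by (subst det_def'[of _ n], simp, rule sum.cong) (auto intro!: prod.cong dest: permutes_in_image)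

lemma fdet_cong:
  assumes "\<And>i j. i < n \<Longrightarrow> j < n \<Longrightarrow> F i j = G i j"
  shows "fdet n F = fdet n G"
  unfolding fdet_def by (rule arg_cong[of _ _ det]) (auto simp: assms)

text \<open>The direct sum of \<open>F[S]\<close> and \<open>G[S']\<close> with all indices left in
  place. A product of complementary principal minors thus becomes a single determinant of size
  \<open>n\<close>.\<close>

definition block_entry ::
  "nat set \<Rightarrow> (nat \<Rightarrow> nat \<Rightarrow> 'a) \<Rightarrow> (nat \<Rightarrow> nat \<Rightarrow> 'a) \<Rightarrow> nat \<Rightarrow> nat \<Rightarrow> 'a :: zero" where
  "block_entry S F G i j =
     (if i \<in> S \<and> j \<in> S then F i j else if i \<notin> S \<and> j \<notin> S then G i j else 0)"

text \<open>The sign of \<open>e\<close> enters once through the rows and once through the columns,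
  and its square is 1.\<close>

lemma det_permute_both:
  fixes A :: "'a :: comm_ring_1 mat"
  assumes A: "A \<in> carrier_mat n n" and e: "e permutes {0..<n}"
  shows "det (mat n n (\<lambda>(i, j). A $$ (e i, e j))) = det A"
proof -
  have e_lt: "e i < n" if "i < n" for i
    using permutes_in_image[OF e, of i] that by simp
  define R where "R = mat n n (\<lambda>(i, j). A $$ (e i, j))"
  have R: "R \<in> carrier_mat n n" by (simp add: R_def)
  have "det (mat n n (\<lambda>(i, j). A $$ (e i, e j)))
      = det (transpose_mat (mat n n (\<lambda>(i, j). transpose_mat R $$ (e i, j))))"
    by (rule arg_cong[of _ _ det]) (auto simp: R_def e_lt)
  also have "\<dots> = det (mat n n (\<lambda>(i, j). transpose_mat R $$ (e i, j)))"
    by (rule det_transpose[of _ n]) simp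
  also have "\<dots> = signof e * det (transpose_mat R)"
    by (rule det_permute_rows[OF _ e]) (simp add: R)
  also have "\<dots> = signof e * (signof e * det A)"
    unfolding det_transpose[OF R] by (simp add: R_def det_permute_rows[OF A e])
  also have "\<dots> = det A" by (simp add: sign_def)
  finally show ?thesis .
qed

text \<open>Moving \<open>S\<close> in front of its complement, in rows and columns alike, makes the
  matrix block diagonal with the two submatrices as blocks.\<close>

lemma det_submatrix_mult_complement:
  fixes A B :: "'a :: idom mat"
  assumes A: "A \<in> carrier_mat n n" and B: "B \<in> carrier_mat n n" and S: "S \<subseteq> {0..<n}"
  shows "det (submatrix A S S) * det (submatrix B ({0..<n} - S) ({0..<n} - S)) =
    fdet n (block_entry S (\<lambda>i j. A $$ (i, j)) (\<lambda>i j. B $$ (i, j)))"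
proof -
  define S' where "S' = {0..<n} - S"
  define k where "k = card S"
  define m where "m = card S'"
  have S': "S' \<subseteq> {0..<n}" by (simp add: S'_def)
  have km: "k + m = n"
    using card_Diff_subset[OF finite_subset[OF S] S] card_mono[OF _ S]
    by (simp add: k_def m_def S'_def)
  have Seq: "{i. i < n \<and> i \<in> S} = S" "{i. i < n \<and> i \<in> S'} = S'"
    using S S' by auto
  have pS: "pick S i \<in> S" if "i < k" for i
    using pick_in_set_le[of i S] that by (simp add: k_def)
  have pS': "pick S' i \<in> S'" if "i < m" for i
    using pick_in_set_le[of i S'] that by (simp add: m_def)
  \<comment> \<open>\<open>e\<close> lists \<open>S\<close> in increasing order, then its
    complement; beyond \<open>n\<close> it is the identity, as \<open>permutes\<close>
    requires.\<close>
  define e where "e i = (if i < k then pick S i else if i < n then pick S' (i - k) else i)" for i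
  have eS: "e i \<in> S" if "i < k" for i using that pS by (simp add: e_def)
  have eS': "e i \<in> S'" if "k \<le> i" "i < n" for i
    using that pS'[of "i - k"] km by (auto simp: e_def)
  have eN: "e i < n" if "i < n" for i
    using eS[of i] eS'[of i] that S S' by (cases "i < k") auto
  have eS_iff: "e i \<in> S \<longleftrightarrow> i < k" if "i < n" for i
    using eS[of i] eS'[of i] that by (cases "i < k") (auto simp: S'_def)
  have inj: "inj_on e {0..<n}"
  proof (rule inj_onI)
    fix i j assume ij: "i \<in> {0..<n}" "j \<in> {0..<n}" and eq: "e i = e j"
    have cl: "i < k \<longleftrightarrow> j < k"
      using eS_iff[of i] eS_iff[of j] ij eq by simp
    show "i = j"
    proof (cases "i < k")
      case True
      then have "pick S i = pick S j" using eq cl by (simp add: e_def)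
      then show ?thesis
        using True cl pick_mono_le[of i S j] pick_mono_le[of j S i]
        by (cases i j rule: linorder_cases) (simp_all add: k_def)
    next
      case False
      then have "pick S' (i - k) = pick S' (j - k)" using eq cl ij by (simp add: e_def)
      moreover have "i - k < card S'" "j - k < card S'"
        using False cl ij km by (auto simp: m_def)
      ultimately have "i - k = j - k"
        using pick_mono_le[of "i - k" S' "j - k"] pick_mono_le[of "j - k" S' "i - k"]
        by (cases "i - k" "j - k" rule: linorder_cases) simp_all
      then show ?thesis using False cl by simp
    qed
  qed
  have e: "e permutes {0..<n}"
  proof (rule bij_imp_permutes)
    have "e ` {0..<n} \<subseteq> {0..<n}" using eN by auto
    then show "bij_betw e {0..<n} {0..<n}"
      using inj by (simp add: bij_betw_def endo_inj_surj)
    show "e i = i" if "i \<notin> {0..<n}" for i using that km by (simp add: e_def)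
  qed
  have dA: "dim_row (submatrix A S S) = k" "dim_col (submatrix A S S) = k"
    using A by (simp_all add: dim_submatrix Seq k_def)
  have dB: "dim_row (submatrix B S' S') = m" "dim_col (submatrix B S' S') = m"
    using B by (simp_all add: dim_submatrix Seq m_def)
  have cA: "submatrix A S S \<in> carrier_mat k k" by (rule carrier_matI) (fact dA)+
  have cB: "submatrix B S' S' \<in> carrier_mat m m" by (rule carrier_matI) (fact dB)+
  define G where "G = mat n n (\<lambda>(i, j). block_entry S (\<lambda>i j. A $$ (i, j)) (\<lambda>i j. B $$ (i, j)) i j)"
  have G: "G \<in> carrier_mat n n" by (simp add: G_def)
  have blocks: "mat n n (\<lambda>(i, j). G $$ (e i, e j)) =
      four_block_mat (submatrix A S S) (0\<^sub>m k m) (0\<^sub>m m k) (submatrix B S' S')" (is "?L = ?R")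
  proof (rule eq_matI)
    show "dim_row ?L = dim_row ?R" "dim_col ?L = dim_col ?R" by (simp_all add: dA dB km)
    fix i j assume "i < dim_row ?R" "j < dim_col ?R"
    then have i: "i < n" and j: "j < n" by (simp_all add: dA dB km)
    have sA: "submatrix A S S $$ (i, j) = A $$ (pick S i, pick S j)" if "i < k" "j < k"
      using A that by (subst submatrix_index) (simp_all add: Seq k_def)
    have sB: "submatrix B S' S' $$ (i - k, j - k) = B $$ (pick S' (i - k), pick S' (j - k))"
      if "\<not> i < k" "\<not> j < k"
      using B that i j km by (subst submatrix_index) (simp_all add: Seq m_def)
    have "?R $$ (i, j) =
        (if i < k then if j < k then A $$ (pick S i, pick S j) else 0
         else if j < k then 0 else B $$ (pick S' (i - k), pick S' (j - k)))"
    proof -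
      have "i < dim_row (submatrix A S S) + dim_row (submatrix B S' S')"
        "j < dim_col (submatrix A S S) + dim_col (submatrix B S' S')"
        using i j km unfolding dA dB by linarith+
      from index_mat_four_block(1)[OF this, of "0\<^sub>m k m" "0\<^sub>m m k", unfolded dA dB]
      show ?thesis
        using i j km sA sB by (cases "i < k"; cases "j < k") simp_all
    qed
    moreover have "?L $$ (i, j) = (if i < k then if j < k then A $$ (e i, e j) else 0
         else if j < k then 0 else B $$ (e i, e j))"
      unfolding G_def block_entry_def using i j eN[OF i] eN[OF j] eS_iff[OF i] eS_iff[OF j]
      by simp
    moreover have "e i = (if i < k then pick S i else pick S' (i - k))"
      "e j = (if j < k then pick S j else pick S' (j - k))"
      using i j by (simp_all add: e_def)
    ultimately show "?L $$ (i, j) = ?R $$ (i, j)"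
      by (cases "i < k"; cases "j < k") simp_all
  qed
  have "fdet n (block_entry S (\<lambda>i j. A $$ (i, j)) (\<lambda>i j. B $$ (i, j))) = det G"
    by (simp add: fdet_def G_def)
  also have "\<dots> = det (mat n n (\<lambda>(i, j). G $$ (e i, e j)))"
    by (rule det_permute_both[OF G e, symmetric])
  also have "\<dots> = det (submatrix A S S) * det (submatrix B S' S')"
    unfolding blocks by (rule det_four_block_mat_upper_right_zero[OF cA refl _ cB]) simp
  finally show ?thesis by (simp add: S'_def)
qed

lemma eta_eq_sum_fdet:
  fixes A B :: "'a :: idom mat"
  assumes A: "A \<in> carrier_mat n n" and B: "B \<in> carrier_mat n n"
  shows "eta A B =
    (\<Sum>S\<in>Pow {0..<n}. fdet n (block_entry S (\<lambda>i j. A $$ (i, j)) (\<lambda>i j. B $$ (i, j))))"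
  using A unfolding eta_def
  by (auto intro!: sum.cong det_submatrix_mult_complement[OF A B])

definition sgn_on :: "nat set \<Rightarrow> nat \<Rightarrow> 'a :: ring_1" where
  "sgn_on T i = (if i \<in> T then - 1 else 1)"

definition sign_flip :: "nat set \<Rightarrow> (nat \<Rightarrow> nat \<Rightarrow> 'a :: ring_1) \<Rightarrow> nat \<Rightarrow> nat \<Rightarrow> 'a" where
  "sign_flip T F i j = sgn_on T i * F i j * sgn_on T j"

lemma sum_prod_sgn_on:
  assumes p: "p permutes {0..<n}" and S: "S \<subseteq> {0..<n}"
  shows "(\<Sum>T\<in>Pow {0..<n}. \<Prod>i\<in>S. sgn_on T i * sgn_on T (p i)) =
    (if p ` S = S then 2 ^ n else (0 :: 'a :: idom))"
proof -
  define h :: "nat \<Rightarrow> 'a" where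
    "h i = (if i \<in> S then - 1 else 1) * (if i \<in> p ` S then - 1 else 1)" for i
  have pS: "p ` S \<subseteq> {0..<n}" using permutes_image[OF p] S by blast
  have restrict: "(\<Prod>i\<in>R. sgn_on T i) = (\<Prod>i\<in>T. if i \<in> R then - 1 else (1 :: 'a))"
    if "R \<subseteq> {0..<n}" "T \<subseteq> {0..<n}" for R T
  proof -
    have fin: "finite R" "finite T" using that finite_subset by blast+
    have "(\<Prod>i\<in>R. sgn_on T i) = (\<Prod>i\<in>R \<inter> T. - 1 :: 'a)"
      unfolding sgn_on_def by (simp add: prod.inter_restrict[OF fin(1), symmetric])
    also have "\<dots> = (\<Prod>i\<in>T. if i \<in> R then - 1 else 1)"
      by (simp add: prod.inter_restrict[OF fin(2), symmetric] Int_commute)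
    finally show ?thesis .
  qed
  have "(\<Prod>i\<in>S. sgn_on T i * sgn_on T (p i)) = (\<Prod>i\<in>T. h i) * (\<Prod>i\<in>{0..<n} - T. 1)"
    if T: "T \<in> Pow {0..<n}" for T
  proof -
    have "(\<Prod>i\<in>S. sgn_on T i * sgn_on T (p i)) = (\<Prod>i\<in>S. sgn_on T i) * (\<Prod>i\<in>p ` S. sgn_on T i :: 'a)"
      by (simp add: prod.distrib prod.reindex[OF inj_on_subset[OF permutes_inj[OF p] subset_UNIV]])
    then show ?thesis using T S pS by (simp add: restrict h_def prod.distrib)
  qed
  then have "(\<Sum>T\<in>Pow {0..<n}. \<Prod>i\<in>S. sgn_on T i * sgn_on T (p i)) =
      (\<Sum>T\<in>Pow {0..<n}. (\<Prod>i\<in>T. h i) * (\<Prod>i\<in>{0..<n} - T. 1))"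
    by (rule sum.cong[OF refl])
  also have "\<dots> = (\<Prod>i\<in>{0..<n}. h i + 1)"
    by (rule prod_add[symmetric]) simp
  also have "\<dots> = (if p ` S = S then 2 ^ n else 0)"
  proof (cases "p ` S = S")
    case True
    then have "h i + 1 = 2" for i by (simp add: h_def)
    then show ?thesis using True by simp
  next
    case False
    then obtain i where i: "i \<in> {0..<n}" "i \<in> S \<longleftrightarrow> i \<notin> p ` S" using S pS by blast
    then have "h i + 1 = 0" by (auto simp: h_def)
    then have "(\<Prod>i\<in>{0..<n}. h i + 1) = 0" using i(1) by (intro prod_zero) auto
    then show ?thesis using False by simp
  qed
  finally show ?thesis .
qed

lemma prod_block_entry:
  assumes p: "p permutes {0..<n}" and S: "S \<subseteq> {0..<n}"
  shows "(\<Prod>i = 0..<n. block_entry S F G i (p i)) =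
    (if p ` S = S then (\<Prod>i\<in>S. F i (p i)) * (\<Prod>i\<in>{0..<n} - S. G i (p i)) else (0 :: 'a :: idom))"
proof -
  have inj: "inj p" by (rule permutes_inj[OF p])
  have finS: "finite S" using S finite_subset by blast
  have split: "(\<Prod>i = 0..<n. f i) = (\<Prod>i\<in>S. f i) * (\<Prod>i\<in>{0..<n} - S. f i)" for f :: "nat \<Rightarrow> 'a"
    by (subst prod.subset_diff[OF S]) (simp_all add: mult.commute)
  show ?thesis
  proof (cases "p ` S = S")
    case True
    have "p i \<in> S \<longleftrightarrow> i \<in> S" for i using True inj by (metis inj_image_mem_iff)
    then show ?thesis using True by (simp add: split block_entry_def)
  next
    case False
    have "\<not> p ` S \<subseteq> S"
      using False finS inj by (metis endo_inj_surj inj_on_subset subset_UNIV)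
    then obtain i where "i \<in> S" "p i \<notin> S" by blast
    then have "block_entry S F G i (p i) = 0" "i \<in> {0..<n}" using S by (auto simp: block_entry_def)
    then have "(\<Prod>i = 0..<n. block_entry S F G i (p i)) = 0" by (intro prod_zero) auto
    then show ?thesis using False by simp
  qed
qed

text \<open>Averaging over the conjugations of \<open>F\<close> by diagonal sign matrices kills every product of a
  minor of \<open>F\<close> with a minor of \<open>G\<close> except the principal ones.\<close>

lemma sum_fdet_sign_flip:
  fixes F G :: "nat \<Rightarrow> nat \<Rightarrow> 'a :: idom"
  shows "(\<Sum>T\<in>Pow {0..<n}. fdet n (\<lambda>i j. sign_flip T F i j + G i j)) =
    2 ^ n * (\<Sum>S\<in>Pow {0..<n}. fdet n (block_entry S F G))"
proof -
  let ?P = "{p. p permutes {0..<n}}" and ?N = "{0..<n}"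
  let ?d = "\<lambda>S p. \<Prod>i\<in>S. F i (p i)" and ?e = "\<lambda>S p. \<Prod>i\<in>?N - S. G i (p i)"
  let ?s = "\<lambda>T S p. \<Prod>i\<in>S. sgn_on T i * sgn_on T (p i) :: 'a"
  have "fdet n (\<lambda>i j. sign_flip T F i j + G i j) =
      (\<Sum>p\<in>?P. \<Sum>S\<in>Pow ?N. ?s T S p * (signof p * ?d S p * ?e S p))" for T
    unfolding fdet_leibniz
  proof (rule sum.cong[OF refl])
    fix p
    have "(\<Prod>i = 0..<n. sign_flip T F i (p i) + G i (p i)) =
        (\<Sum>S\<in>Pow ?N. (\<Prod>i\<in>S. sign_flip T F i (p i)) * ?e S p)"
      by (rule prod_add) simp
    also have "\<dots> = (\<Sum>S\<in>Pow ?N. ?s T S p * ?d S p * ?e S p)"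
      by (rule sum.cong[OF refl]) (simp add: sign_flip_def prod.distrib mult_ac)
    finally show "signof p * (\<Prod>i = 0..<n. sign_flip T F i (p i) + G i (p i)) =
        (\<Sum>S\<in>Pow ?N. ?s T S p * (signof p * ?d S p * ?e S p))"
      by (simp add: sum_distrib_left mult_ac)
  qed
  then have "(\<Sum>T\<in>Pow ?N. fdet n (\<lambda>i j. sign_flip T F i j + G i j)) =
      (\<Sum>T\<in>Pow ?N. \<Sum>p\<in>?P. \<Sum>S\<in>Pow ?N. ?s T S p * (signof p * ?d S p * ?e S p))"
    by simp
  also have "\<dots> = (\<Sum>p\<in>?P. \<Sum>T\<in>Pow ?N. \<Sum>S\<in>Pow ?N. ?s T S p * (signof p * ?d S p * ?e S p))"
    by (rule sum.swap)
  also have "\<dots> = (\<Sum>p\<in>?P. \<Sum>S\<in>Pow ?N. \<Sum>T\<in>Pow ?N. ?s T S p * (signof p * ?d S p * ?e S p))"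
    by (rule sum.cong[OF refl], rule sum.swap)
  also have "\<dots> = (\<Sum>p\<in>?P. \<Sum>S\<in>Pow ?N. 2 ^ n * (signof p * (\<Prod>i = 0..<n. block_entry S F G i (p i))))"
  proof (intro sum.cong refl)
    fix p S assume "p \<in> ?P" "S \<in> Pow ?N"
    then have p: "p permutes ?N" and S: "S \<subseteq> ?N" by simp_all
    show "(\<Sum>T\<in>Pow ?N. ?s T S p * (signof p * ?d S p * ?e S p)) =
        2 ^ n * (signof p * (\<Prod>i = 0..<n. block_entry S F G i (p i)))"
      unfolding sum_distrib_right[symmetric] sum_prod_sgn_on[OF p S] prod_block_entry[OF p S]
      by simp
  qed
  also have "\<dots> = (\<Sum>S\<in>Pow ?N. \<Sum>p\<in>?P. 2 ^ n * (signof p * (\<Prod>i = 0..<n. block_entry S F G i (p i))))"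
    by (rule sum.swap)
  also have "\<dots> = 2 ^ n * (\<Sum>S\<in>Pow ?N. fdet n (block_entry S F G))"
    by (simp add: fdet_leibniz sum_distrib_left)
  finally show ?thesis .
qed

section \<open>Nonvanishing of sign averages\<close>

text \<open>Conjugate-linear in the first argument. Only the values of the vectors on
  \<open>I\<close> matter, and \<open>I\<close> is arbitrary because diagonalization will remove
  indices from it.\<close>

definition sesq :: "nat set \<Rightarrow> (nat \<Rightarrow> nat \<Rightarrow> complex) \<Rightarrow> (nat \<Rightarrow> complex) \<Rightarrow> (nat \<Rightarrow> complex) \<Rightarrow> complex"
  where "sesq I M x y = (\<Sum>i\<in>I. \<Sum>j\<in>I. cnj (x i) * M i j * y j)"

lemma sesq_add_matrix: "sesq I (\<lambda>i j. M i j + N i j) x y = sesq I M x y + sesq I N x y"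
  by (simp add: sesq_def algebra_simps sum.distrib)

text \<open>The imaginary part of the form of \<open>M\<close> is the form of
  \<open>(M - N) / (2i)\<close>, with \<open>N\<close> the adjoint of \<open>M\<close>; this asks it
  to be positive definite, for \<open>M\<close> that need not be Hermitian.\<close>

definition im_pos :: "nat set \<Rightarrow> (nat \<Rightarrow> nat \<Rightarrow> complex) \<Rightarrow> bool" where
  "im_pos I M \<longleftrightarrow> (\<forall>v. (\<exists>i\<in>I. v i \<noteq> 0) \<longrightarrow> Im (sesq I M v v) > 0)"

definition im_nonneg :: "nat set \<Rightarrow> (nat \<Rightarrow> nat \<Rightarrow> complex) \<Rightarrow> bool" where
  "im_nonneg I M \<longleftrightarrow> (\<forall>v. Im (sesq I M v v) \<ge> 0)"

lemma sesq_zero: "(\<And>i. i \<in> I \<Longrightarrow> v i = 0) \<Longrightarrow> sesq I M v w = 0"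
  by (simp add: sesq_def)

lemma im_pos_imp_nonneg: "im_pos I M \<Longrightarrow> im_nonneg I M"
  unfolding im_pos_def im_nonneg_def
  using sesq_zero[of I _ M] by (metis less_eq_real_def zero_complex.sel(2))

lemma fdet_eq_0_imp_kernel:
  fixes F :: "nat \<Rightarrow> nat \<Rightarrow> 'a :: idom"
  assumes "fdet n F = 0"
  obtains x where "\<exists>i<n. x i \<noteq> 0" "\<And>i. i < n \<Longrightarrow> (\<Sum>j = 0..<n. F i j * x j) = 0"
proof -
  let ?M = "mat n n (\<lambda>(i, j). F i j)"
  obtain v where v: "v \<in> carrier_vec n" "v \<noteq> 0\<^sub>v n" "?M *\<^sub>v v = 0\<^sub>v n"
    using assms det_0_iff_vec_prod_zero[of ?M n] by (auto simp: fdet_def)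
  have "\<exists>i<n. v $ i \<noteq> 0" using v by (auto simp: vec_eq_iff)
  moreover have "(\<Sum>j = 0..<n. F i j * v $ j) = 0" if "i < n" for i
  proof -
    have "(?M *\<^sub>v v) $ i = 0" using v(3) that by simp
    then show ?thesis using that v(1) by (simp add: scalar_prod_def)
  qed
  ultimately show thesis by (rule that)
qed

text \<open>A kernel vector \<open>x\<close> would be a zero of the form of \<open>P + C\<close>,
  whose imaginary part at \<open>x\<close> is positive.\<close>

lemma fdet_neq_0_if_im_pos:
  assumes P: "im_pos {0..<n} P" and C: "im_nonneg {0..<n} C"
  shows "fdet n (\<lambda>i j. P i j + C i j) \<noteq> 0"
proof
  assume "fdet n (\<lambda>i j. P i j + C i j) = 0"
  then obtain x where x: "\<exists>i<n. x i \<noteq> 0"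
    and ker: "\<And>i. i < n \<Longrightarrow> (\<Sum>j = 0..<n. (P i j + C i j) * x j) = 0"
    by (rule fdet_eq_0_imp_kernel) blast
  have "sesq {0..<n} (\<lambda>i j. P i j + C i j) x x =
      (\<Sum>i = 0..<n. cnj (x i) * (\<Sum>j = 0..<n. (P i j + C i j) * x j))"
    by (simp add: sesq_def sum_distrib_left mult.assoc)
  then have "sesq {0..<n} P x x + sesq {0..<n} C x x = 0"
    by (simp add: sesq_add_matrix ker)
  moreover have "Im (sesq {0..<n} P x x) > 0" using P x unfolding im_pos_def by (metis atLeastLessThan_iff le0)
  moreover have "Im (sesq {0..<n} C x x) \<ge> 0" using C by (auto simp: im_nonneg_def)
  ultimately show False
    by (metis add_pos_nonneg less_irrefl plus_complex.sel(2) zero_complex.sel(2))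
qed

section \<open>Dependence of the partial sign sums on one diagonal entry\<close>

definition add_diag :: "nat \<Rightarrow> 'a \<Rightarrow> (nat \<Rightarrow> nat \<Rightarrow> 'a :: monoid_add) \<Rightarrow> nat \<Rightarrow> nat \<Rightarrow> 'a" where
  "add_diag k x F i j = F i j + (if i = k \<and> j = k then x else 0)"

text \<open>For \<open>k < n\<close> its determinant is the principal minor with row and column
  \<open>k\<close> deleted; keeping the size \<open>n\<close> avoids renumbering.\<close>

definition unit_cross :: "nat \<Rightarrow> (nat \<Rightarrow> nat \<Rightarrow> 'a) \<Rightarrow> nat \<Rightarrow> nat \<Rightarrow> 'a :: zero_neq_one" where
  "unit_cross k F i j = (if i = k \<or> j = k then if i = j then 1 else 0 else F i j)"

text \<open>Only the permutations that fix \<open>k\<close> meet the entry at \<open>(k, k)\<close>,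
  so the determinant is affine in it with the complementary minor as slope.\<close>

lemma fdet_add_diag:
  fixes F :: "nat \<Rightarrow> nat \<Rightarrow> 'a :: idom"
  assumes k: "k < n"
  shows "fdet n (add_diag k x F) = fdet n F + x * fdet n (unit_cross k F)"
proof -
  have split: "(\<Prod>i = 0..<n. f i) = f k * (\<Prod>i\<in>{0..<n} - {k}. f i)" for f :: "nat \<Rightarrow> 'a"
    by (rule prod.remove) (use k in auto)
  have "(\<Prod>i = 0..<n. add_diag k x F i (p i)) =
      (\<Prod>i = 0..<n. F i (p i)) + x * (\<Prod>i = 0..<n. unit_cross k F i (p i))"
    if p: "p permutes {0..<n}" for p
  proof -
    have inj: "p i = k \<Longrightarrow> p k = k \<Longrightarrow> i = k" for i
      using permutes_inj[OF p] by (metis injD)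
    have "(\<Prod>i\<in>{0..<n} - {k}. add_diag k x F i (p i)) = (\<Prod>i\<in>{0..<n} - {k}. F i (p i))"
      by (rule prod.cong) (auto simp: add_diag_def)
    moreover have "(\<Prod>i\<in>{0..<n} - {k}. unit_cross k F i (p i)) = (\<Prod>i\<in>{0..<n} - {k}. F i (p i))"
      if "p k = k"
      by (rule prod.cong) (use that inj in \<open>auto simp: unit_cross_def\<close>)
    moreover have "add_diag k x F k (p k) = F k (p k) + x * unit_cross k F k (p k)"
      by (simp add: add_diag_def unit_cross_def)
    moreover have "unit_cross k F k (p k) = 0" if "p k \<noteq> k"
      using that by (auto simp: unit_cross_def)
    ultimately show ?thesis
      by (cases "p k = k") (simp_all add: split algebra_simps)
  qed
  then show ?thesis
    by (simp add: fdet_leibniz algebra_simps sum.distrib sum_distrib_left)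
qed

lemma fdet_zero_row:
  assumes "k < n" and "\<And>j. j < n \<Longrightarrow> F k j = 0"
  shows "fdet n F = 0"
  unfolding fdet_leibniz
proof (rule sum.neutral, safe)
  fix p assume "p permutes {0..<n}"
  then have "F k (p k) = 0"
    using assms permutes_in_image[of p "{0..<n}" k] by auto
  then have "(\<Prod>i = 0..<n. F i (p i)) = 0" using assms(1) by (intro prod_zero) auto
  then show "signof p * (\<Prod>i = 0..<n. F i (p i)) = 0" by simp
qed

text \<open>Only the signs at indices in \<open>K\<close> vary, which allows induction on
  \<open>K\<close>: the empty set gives one determinant, and \<open>{0..<n}\<close> gives the full
  sign sum.\<close>

definition flip_sum :: "nat \<Rightarrow> nat set \<Rightarrow> (nat \<Rightarrow> nat \<Rightarrow> 'a) \<Rightarrow> (nat \<Rightarrow> nat \<Rightarrow> 'a) \<Rightarrow> 'a :: comm_ring_1"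
  where "flip_sum n K P C = (\<Sum>T\<in>Pow K. fdet n (\<lambda>i j. sign_flip T P i j + C i j))"

text \<open>The sets containing \<open>k\<close> form a second copy of the sum over
  \<open>K\<close>, with the sign at \<open>k\<close> absorbed into \<open>P\<close>.\<close>

lemma flip_sum_insert:
  assumes "finite K" "k \<notin> K"
  shows "flip_sum n (insert k K) P C = flip_sum n K P C + flip_sum n K (sign_flip {k} P) C"
proof -
  have eq: "sign_flip (insert k T) P = sign_flip T (sign_flip {k} P)" if "T \<in> Pow K" for T
    using that assms(2) by (intro ext) (auto simp: sign_flip_def sgn_on_def)
  have "flip_sum n (insert k K) P C =
      flip_sum n K P C + (\<Sum>T\<in>insert k ` Pow K. fdet n (\<lambda>i j. sign_flip T P i j + C i j))"
    unfolding flip_sum_def Pow_insert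
    by (rule sum.union_disjoint) (use assms in auto)
  also have "(\<Sum>T\<in>insert k ` Pow K. fdet n (\<lambda>i j. sign_flip T P i j + C i j)) =
      (\<Sum>T\<in>Pow K. fdet n (\<lambda>i j. sign_flip (insert k T) P i j + C i j))"
    by (subst sum.reindex) (use assms in \<open>auto simp: inj_on_def\<close>)
  also have "\<dots> = flip_sum n K (sign_flip {k} P) C"
    unfolding flip_sum_def by (rule sum.cong[OF refl], subst eq) (rule refl | assumption)+
  finally show ?thesis .
qed

definition zero_cross :: "nat \<Rightarrow> (nat \<Rightarrow> nat \<Rightarrow> 'a) \<Rightarrow> nat \<Rightarrow> nat \<Rightarrow> 'a :: zero" where
  "zero_cross k F i j = (if (i = k) \<noteq> (j = k) then 0 else F i j)"

lemma flip_sum_add_diag: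
  fixes P C :: "nat \<Rightarrow> nat \<Rightarrow> 'a :: idom"
  assumes "k < n"
  shows "flip_sum n K P (add_diag k x C) =
    flip_sum n K P C + x * (\<Sum>T\<in>Pow K. fdet n (unit_cross k (\<lambda>i j. sign_flip T P i j + C i j)))"
proof -
  have "(\<lambda>i j. sign_flip T P i j + add_diag k x C i j) =
      add_diag k x (\<lambda>i j. sign_flip T P i j + C i j)" for T
    by (simp add: add_diag_def add.assoc fun_eq_iff)
  then show ?thesis
    by (simp add: flip_sum_def fdet_add_diag[OF assms] sum.distrib sum_distrib_left)
qed

text \<open>What this is for: up to the factor \<open>P k k\<close>, the slope in
  \<open>flip_sum_add_diag\<close> is itself a partial sign sum, so its nonvanishing can come from
  the same induction. With \<open>C\<close> cut off at \<open>k\<close> and \<open>P\<close>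
  decoupled there, \<open>P k k\<close> is all that remains in row \<open>k\<close>, and only the
  slope term of \<open>fdet_add_diag\<close> survives.\<close>

lemma flip_sum_zero_cross:
  fixes P C :: "nat \<Rightarrow> nat \<Rightarrow> 'a :: idom"
  assumes k: "k < n" and K: "k \<notin> K"
  shows "flip_sum n K (zero_cross k P) (\<lambda>i j. if i = k \<or> j = k then 0 else C i j) =
    P k k * (\<Sum>T\<in>Pow K. fdet n (unit_cross k (\<lambda>i j. sign_flip T P i j + C i j)))"
  unfolding flip_sum_def sum_distrib_left
proof (rule sum.cong[OF refl])
  fix T assume T: "T \<in> Pow K"
  define F where "F i j = (if i = k \<or> j = k then 0 else sign_flip T P i j + C i j)" for i j
  have "(\<lambda>i j. sign_flip T (zero_cross k P) i j + (if i = k \<or> j = k then 0 else C i j)) =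
      add_diag k (P k k) F"
    using K T by (intro ext) (auto simp: add_diag_def F_def sign_flip_def zero_cross_def sgn_on_def)
  moreover have "fdet n F = 0" by (rule fdet_zero_row[OF k]) (simp add: F_def)
  moreover have "unit_cross k F = unit_cross k (\<lambda>i j. sign_flip T P i j + C i j)"
    by (auto simp: unit_cross_def F_def fun_eq_iff)
  ultimately show "fdet n (\<lambda>i j. sign_flip T (zero_cross k P) i j + (if i = k \<or> j = k then 0 else C i j)) =
      P k k * fdet n (unit_cross k (\<lambda>i j. sign_flip T P i j + C i j))"
    by (simp add: fdet_add_diag[OF k])
qed

lemma sesq_sign_flip:
  "sesq I (sign_flip T P) v w = sesq I P (\<lambda>i. sgn_on T i * v i) (\<lambda>i. sgn_on T i * w i)"
  unfolding sesq_def sign_flip_def sgn_on_def by (intro sum.cong refl) simp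

lemma im_pos_sign_flip: "im_pos I P \<Longrightarrow> im_pos I (sign_flip T P)"
  unfolding im_pos_def sesq_sign_flip by (auto simp: sgn_on_def)

text \<open>The erased entries are exactly the cross terms between the part of \<open>v\<close> at
  \<open>k\<close> and the rest, so the form becomes the sum of its values at the two parts.\<close>

lemma im_pos_zero_cross:
  assumes P: "im_pos I P"
  shows "im_pos I (zero_cross k P)"
  unfolding im_pos_def
proof (intro allI impI)
  fix v :: "nat \<Rightarrow> complex" assume v: "\<exists>i\<in>I. v i \<noteq> 0"
  define a where "a i = (if i = k then 0 else v i)" for i
  define b where "b i = (if i = k then v i else 0)" for i
  have "sesq I (zero_cross k P) v v = sesq I P a a + sesq I P b b"
    unfolding sesq_def sum.distrib[symmetric]
    by (intro sum.cong refl) (auto simp: zero_cross_def a_def b_def)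
  moreover have "Im (sesq I P a a) \<ge> 0" "Im (sesq I P b b) \<ge> 0"
    using im_pos_imp_nonneg[OF P] by (auto simp: im_nonneg_def)
  moreover have "Im (sesq I P a a) > 0 \<or> Im (sesq I P b b) > 0"
  proof -
    have "(\<exists>i\<in>I. a i \<noteq> 0) \<or> (\<exists>i\<in>I. b i \<noteq> 0)" using v by (auto simp: a_def b_def)
    then show ?thesis using P by (auto simp: im_pos_def)
  qed
  ultimately show "Im (sesq I (zero_cross k P) v v) > 0" by auto
qed

lemma im_nonneg_delete:
  assumes "im_nonneg I C"
  shows "im_nonneg I (\<lambda>i j. if i = k \<or> j = k then 0 else C i j)"
  unfolding im_nonneg_def
proof
  fix v :: "nat \<Rightarrow> complex"
  define a where "a i = (if i = k then 0 else v i)" for i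
  have "sesq I (\<lambda>i j. if i = k \<or> j = k then 0 else C i j) v v = sesq I C a a"
    unfolding sesq_def by (intro sum.cong refl) (auto simp: a_def)
  then show "Im (sesq I (\<lambda>i j. if i = k \<or> j = k then 0 else C i j) v v) \<ge> 0"
    using assms by (simp add: im_nonneg_def)
qed

lemma im_nonneg_add_diag:
  assumes "finite I" "im_nonneg I C" "Im x \<ge> 0"
  shows "im_nonneg I (add_diag k x C)"
  unfolding im_nonneg_def
proof
  fix v :: "nat \<Rightarrow> complex"
  have "sesq I (add_diag k x C) v v =
      sesq I C v v + (\<Sum>i\<in>I. \<Sum>j\<in>I. if j = k then if i = k then cnj (v i) * x * v j else 0 else 0)"
    unfolding sesq_def sum.distrib[symmetric]
    by (intro sum.cong refl) (auto simp: add_diag_def algebra_simps)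
  also have "\<dots> = sesq I C v v + (if k \<in> I then cnj (v k) * x * v k else 0)"
    using assms(1) by (simp add: sum.delta)
  finally have eq: "sesq I (add_diag k x C) v v = \<dots>" .
  have "Im (cnj (v k) * x * v k) = Im x * (cmod (v k))\<^sup>2"
    unfolding cmod_power2 by (simp add: algebra_simps power2_eq_square)
  then show "Im (sesq I (add_diag k x C) v v) \<ge> 0"
    using assms by (simp add: eq im_nonneg_def)
qed

text \<open>As a function of an extra diagonal entry \<open>x\<close> at \<open>k\<close>, both halves of the sum for
  \<open>insert k K\<close> are affine in \<open>x\<close> with the same slope, because the slope does not see row and column
  \<open>k\<close>. Having no zero with \<open>Im x \<ge> 0\<close> puts both quotients by the slope in the open upper half-plane,
  which is convex.\<close>

lemma flip_sum_neq_0: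
  assumes "finite K" "K \<subseteq> {0..<n}" "im_pos {0..<n} P" "im_nonneg {0..<n} C"
  shows "flip_sum n K P C \<noteq> 0"
  using assms
proof (induction K arbitrary: P C rule: finite_induct)
  case empty
  then show ?case
    using fdet_neq_0_if_im_pos[of n P C] by (simp add: flip_sum_def sign_flip_def sgn_on_def)
next
  case (insert k K)
  have k: "k < n" and K: "K \<subseteq> {0..<n}" using insert.prems by auto
  define g where "g Q = (\<Sum>T\<in>Pow K. fdet n (unit_cross k (\<lambda>i j. sign_flip T Q i j + C i j)))" for Q
  let ?Q = "sign_flip {k} P"
  have g_eq: "g ?Q = g P"
  proof -
    have "unit_cross k (\<lambda>i j. sign_flip T ?Q i j + C i j) =
        unit_cross k (\<lambda>i j. sign_flip T P i j + C i j)" for T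
      by (auto simp: unit_cross_def sign_flip_def sgn_on_def fun_eq_iff)
    then show ?thesis by (simp add: g_def)
  qed
  \<comment> \<open>The slope has to be nonzero before anything can be divided by it. Times
    \<open>P k k\<close> it is the sum over \<open>K\<close> for the pair decoupled at
    \<open>k\<close>, which is covered because the induction hypothesis holds for all
    \<open>P\<close> and \<open>C\<close>.\<close>
  have "P k k * g P \<noteq> 0"
    unfolding g_def flip_sum_zero_cross[OF k insert.hyps(2), symmetric]
    by (intro insert.IH K im_pos_zero_cross im_nonneg_delete insert.prems)
  then have g: "g P \<noteq> 0" by simp
  have im: "Im (flip_sum n K R C / g P) > 0" if R: "im_pos {0..<n} R" "g R = g P" for R
  proof (rule ccontr)
    define x where "x = - (flip_sum n K R C / g P)"
    assume "\<not> Im (flip_sum n K R C / g P) > 0"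
    then have "Im x \<ge> 0" by (simp add: x_def)
    then have "flip_sum n K R (add_diag k x C) \<noteq> 0"
      using insert.IH[OF K R(1)] im_nonneg_add_diag[OF _ insert.prems(3)] by simp
    moreover have "flip_sum n K R (add_diag k x C) = flip_sum n K R C + x * g R"
      unfolding g_def by (rule flip_sum_add_diag[OF k])
    ultimately show False using g R(2) by (simp add: x_def)
  qed
  have "Im ((flip_sum n K P C + flip_sum n K ?Q C) / g P) > 0"
    using im[OF insert.prems(2) refl] im[OF im_pos_sign_flip[OF insert.prems(2)] g_eq]
    by (simp add: add_divide_distrib)
  then show ?case
    unfolding flip_sum_insert[OF insert.hyps] by auto
qed

section \<open>Diagonalization by congruence\<close>

lemma sesq_add_right: "sesq I M x (\<lambda>i. y i + z i) = sesq I M x y + sesq I M x z"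
  by (simp add: sesq_def algebra_simps sum.distrib)

lemma sesq_scale_right: "sesq I M x (\<lambda>i. c * y i) = c * sesq I M x y"
  by (simp add: sesq_def sum_distrib_left mult_ac)

lemma sesq_sum_right: "sesq I M x (\<lambda>i. \<Sum>a\<in>A. y a i) = (\<Sum>a\<in>A. sesq I M x (y a))"
  by (induction A rule: infinite_finite_induct)
    (simp_all add: sesq_add_right sesq_def)

definition hermitian_on :: "nat set \<Rightarrow> (nat \<Rightarrow> nat \<Rightarrow> complex) \<Rightarrow> bool" where
  "hermitian_on I M \<longleftrightarrow> (\<forall>i\<in>I. \<forall>j\<in>I. cnj (M i j) = M j i)"

lemma sesq_hermitian:
  assumes "hermitian_on I M"
  shows "cnj (sesq I M x y) = sesq I M y x"
proof -
  have "cnj (sesq I M x y) = (\<Sum>i\<in>I. \<Sum>j\<in>I. cnj (y j) * M j i * x i)"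
    using assms by (auto simp: sesq_def hermitian_on_def intro!: sum.cong)
  also have "\<dots> = sesq I M y x"
    unfolding sesq_def by (rule sum.swap)
  finally show ?thesis .
qed

lemma sesq_hermitian_real:
  assumes "hermitian_on I M"
  shows "sesq I M x x = of_real (Re (sesq I M x x))"
  using sesq_hermitian[OF assms, of x x] by (metis Reals_cnj_iff of_real_Re)

lemma sesq_sum_left:
  assumes "hermitian_on I M"
  shows "sesq I M (\<lambda>i. \<Sum>a\<in>A. c a * x a i) y = (\<Sum>a\<in>A. cnj (c a) * sesq I M (x a) y)"
proof -
  have "sesq I M (\<lambda>i. \<Sum>a\<in>A. c a * x a i) y = cnj (sesq I M y (\<lambda>i. \<Sum>a\<in>A. c a * x a i))"
    by (simp add: sesq_hermitian[OF assms])
  then show ?thesis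
    by (simp add: sesq_sum_right sesq_scale_right sesq_hermitian[OF assms])
qed

lemma sesq_delta:
  assumes "finite I" "i \<in> I" "j \<in> I"
  shows "sesq I M (\<lambda>k. of_bool (k = i)) (\<lambda>k. of_bool (k = j)) = M i j"
  using assms by (simp add: sesq_def of_bool_def if_distrib[of cnj] sum.delta
      if_distrib[of "\<lambda>x. x * _"] if_distrib[of "\<lambda>x. _ * x"] cong: if_cong)

text \<open>Polarization: a Hermitian form that vanishes on the diagonal \<open>x = y\<close>
  vanishes altogether.\<close>

lemma sesq_anisotropic:
  assumes fin: "finite I" and herm: "hermitian_on I M" and ij: "i \<in> I" "j \<in> I" "M i j \<noteq> 0"
  obtains v where "sesq I M v v \<noteq> 0"
proof (rule ccontr)
  assume "\<not> thesis"
  then have null: "sesq I M v v = 0" for v using that by blast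
  let ?e = "\<lambda>a k. of_bool (k = a) :: complex"
  have add_left: "sesq I M (\<lambda>k. x k + y k) z = sesq I M x z + sesq I M y z" for x y z
    by (simp add: sesq_def algebra_simps sum.distrib)
  have scale_left: "sesq I M (\<lambda>k. c * x k) z = cnj c * sesq I M x z" for c x z
    by (simp add: sesq_def sum_distrib_left mult_ac)
  \<comment> \<open>With this factor both cross terms equal the squared modulus of
    \<open>M i j\<close>, so they cannot cancel.\<close>
  define c where "c = cnj (M i j)"
  have "0 = sesq I M (\<lambda>k. ?e i k + c * ?e j k) (\<lambda>k. ?e i k + c * ?e j k)"
    by (rule null[symmetric])
  also have "\<dots> = c * sesq I M (?e i) (?e j) + cnj c * sesq I M (?e j) (?e i)"
    by (simp only: sesq_add_right sesq_scale_right add_left scale_left null) simp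
  also have "\<dots> = c * M i j + cnj c * cnj (M i j)"
    using herm ij by (simp only: sesq_delta[OF fin] hermitian_on_def)
  also have "\<dots> = 2 * of_real ((cmod (M i j))\<^sup>2)"
    using complex_norm_square[of "M i j"] by (simp add: c_def mult.commute)
  finally show False using ij by simp
qed

text \<open>Invertibility of the square matrix \<open>W\<close>, in a form that makes sense on index
  sets that are not of the shape \<open>{0..<n}\<close>.\<close>

definition inj_on_vectors :: "nat set \<Rightarrow> (nat \<Rightarrow> nat \<Rightarrow> complex) \<Rightarrow> bool" where
  "inj_on_vectors I W \<longleftrightarrow>
     (\<forall>x. (\<forall>i\<in>I. (\<Sum>j\<in>I. W i j * x j) = 0) \<longrightarrow> (\<forall>j\<in>I. x j = 0))"

text \<open>Orthogonalization for a possibly indefinite form: split off a vector \<open>v\<close>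
  with nonzero value, project the other basis vectors along \<open>v\<close>, and recurse on their
  Gram matrix, which has one index fewer. The columns of \<open>W\<close> are the resulting
  basis.\<close>

lemma hermitian_congruent_diagonal:
  assumes "finite I" "hermitian_on I M"
  obtains W b where "inj_on_vectors I W"
    "\<And>i j. i \<in> I \<Longrightarrow> j \<in> I \<Longrightarrow>
       sesq I M (\<lambda>k. W k i) (\<lambda>k. W k j) = (if i = j then of_real (b i) else 0)"
proof -
  have "\<exists>W b. inj_on_vectors I W \<and> (\<forall>i\<in>I. \<forall>j\<in>I.
       sesq I M (\<lambda>k. W k i) (\<lambda>k. W k j) = (if i = j then of_real (b i) else 0))"
    using assms
  proof (induction "card I" arbitrary: I M rule: less_induct)
    case less
    note fin = less.prems(1) and herm = less.prems(2)
    show ?case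
    proof (cases "\<exists>i\<in>I. \<exists>j\<in>I. M i j \<noteq> 0")
      case False
      have "inj_on_vectors I (\<lambda>i j. of_bool (i = j))"
        using fin by (simp add: inj_on_vectors_def of_bool_def if_distrib[of "\<lambda>x. x * _"] sum.delta
            cong: if_cong)
      moreover have "sesq I M x y = 0" for x y
        using False by (simp add: sesq_def)
      ultimately show ?thesis
        by (intro exI[of _ "\<lambda>i j. of_bool (i = j)"] exI[of _ "\<lambda>_. 0"]) simp
    next
      case True
      then obtain v where v: "sesq I M v v \<noteq> 0"
        using sesq_anisotropic[OF fin herm] by blast
      define \<beta> where "\<beta> = sesq I M v v"
      \<comment> \<open>The vector \<open>v\<close> takes the place of the \<open>m\<close>-th unit
        vector in the basis; \<open>v m\<close> being nonzero keeps the family independent.\<close>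
      have "\<exists>m\<in>I. v m \<noteq> 0" using v sesq_zero[of I v M v] by blast
      then obtain m where m: "m \<in> I" "v m \<noteq> 0" by blast
      define J where "J = I - {m}"
      have J: "finite J" "m \<notin> J" "I = insert m J"
        using fin m(1) unfolding J_def by auto
      have card: "card J < card I"
        unfolding J_def using fin m(1) by (rule card_Diff1_less)
      \<comment> \<open>The coefficient of the projection onto \<open>v\<close>, so that
        \<open>u j\<close>, the unit vector at \<open>j\<close> minus \<open>c j\<close> times
        \<open>v\<close>, is orthogonal to \<open>v\<close>.\<close>
      define c where "c j = sesq I M v (\<lambda>k. of_bool (k = j)) / \<beta>" for j
      define u where "u j k = of_bool (k = j) - c j * v k" for j k
      have orth: "sesq I M v (u j) = 0" for j
      proof -
        have "sesq I M v (\<lambda>k. of_bool (k = j) + (- c j) * v k) = 0"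
          using v by (simp only: sesq_add_right sesq_scale_right) (simp add: c_def \<beta>_def)
        then show ?thesis by (simp add: u_def[abs_def])
      qed
      define N where "N i j = sesq I M (u i) (u j)" for i j
      have "hermitian_on J N"
        by (simp add: hermitian_on_def N_def sesq_hermitian[OF herm])
      then obtain V d where V: "inj_on_vectors J V"
        and d: "\<And>i j. i \<in> J \<Longrightarrow> j \<in> J \<Longrightarrow>
          sesq J N (\<lambda>k. V k i) (\<lambda>k. V k j) = (if i = j then of_real (d i) else 0)"
        using less.hyps[OF card J(1)] by blast
      define w where "w j k = (\<Sum>i\<in>J. V i j * u i k)" for j k
      define W where "W k j = (if j = m then v k else w j k)" for k j
      define b where "b j = (if j = m then Re \<beta> else d j)" for j
      have colW: "(\<lambda>k. W k j) = (if j = m then v else w j)" for j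
        by (simp add: W_def fun_eq_iff)
      have vw: "sesq I M v (w j) = 0" for j
        by (simp add: w_def[abs_def] sesq_sum_right sesq_scale_right orth)
      have wv: "sesq I M (w j) v = 0" for j
        using vw[of j] sesq_hermitian[OF herm, of v "w j"] by simp
      have ww: "sesq I M (w i) (w j) = sesq J N (\<lambda>k. V k i) (\<lambda>k. V k j)" for i j
      proof -
        have "sesq I M (w i) (w j) = (\<Sum>k\<in>J. cnj (V k i) * (\<Sum>l\<in>J. V l j * N k l))"
          unfolding w_def[abs_def] N_def
          by (subst sesq_sum_left[OF herm]) (simp only: sesq_sum_right sesq_scale_right)
        then show ?thesis by (simp add: sesq_def sum_distrib_left mult_ac)
      qed
      have "inj_on_vectors I W"
        unfolding inj_on_vectors_def
      proof (intro allI impI)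
        fix x assume x: "\<forall>k\<in>I. (\<Sum>j\<in>I. W k j * x j) = 0"
        \<comment> \<open>These are the coordinates of \<open>W x\<close>: it equals
          \<open>s\<close> times \<open>v\<close> plus the unit vectors at \<open>i\<close> in
          \<open>J\<close> weighted by \<open>y i\<close>. At \<open>m\<close> only the term with
          \<open>v\<close> is left, which forces \<open>s = 0\<close>.\<close>
        define y where "y i = (\<Sum>j\<in>J. V i j * x j)" for i
        define s where "s = x m - (\<Sum>i\<in>J. y i * c i)"
        have expand: "(\<Sum>j\<in>I. W k j * x j) = s * v k + (\<Sum>i\<in>J. y i * of_bool (k = i))" for k
        proof -
          have "(\<Sum>j\<in>I. W k j * x j) = v k * x m + (\<Sum>j\<in>J. w j k * x j)"
          proof -
            have "(\<Sum>j\<in>J. W k j * x j) = (\<Sum>j\<in>J. w j k * x j)"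
              by (rule sum.cong) (use J(2) in \<open>auto simp: W_def\<close>)
            then show ?thesis using J by (simp add: W_def)
          qed
          also have "(\<Sum>j\<in>J. w j k * x j) = (\<Sum>j\<in>J. \<Sum>i\<in>J. V i j * x j * u i k)"
            by (simp add: w_def sum_distrib_left sum_distrib_right mult_ac)
          also have "\<dots> = (\<Sum>i\<in>J. y i * u i k)"
            by (subst sum.swap) (simp add: y_def sum_distrib_right)
          also have "\<dots> = (\<Sum>i\<in>J. y i * of_bool (k = i)) - (\<Sum>i\<in>J. y i * c i) * v k"
            by (simp add: u_def algebra_simps sum_subtractf sum_distrib_left)
          finally show ?thesis by (simp add: s_def algebra_simps)
        qed
        have delta: "(\<Sum>i\<in>J. y i * of_bool (k = i)) = (if k \<in> J then y k else 0)" for k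
          using J(1) by (simp add: of_bool_def if_distrib[of "\<lambda>x. _ * x"] sum.delta cong: if_cong)
        have "s * v m = 0" using x m(1) J(2) expand[of m] delta[of m] by simp
        then have s: "s = 0" using m(2) by simp
        have y: "y k = 0" if "k \<in> J" for k
          using x J(3) expand[of k] delta[of k] s that by simp
        then have "\<forall>j\<in>J. x j = 0"
          using V unfolding inj_on_vectors_def y_def by blast
        moreover have "x m = 0" using s y by (simp add: s_def)
        ultimately show "\<forall>j\<in>I. x j = 0" using J(3) by blast
      qed
      moreover have "sesq I M (\<lambda>k. W k i) (\<lambda>k. W k j) = (if i = j then of_real (b i) else 0)"
        if "i \<in> I" "j \<in> I" for i j
      proof -
        have "i = m \<or> i \<in> J" "j = m \<or> j \<in> J" using that by (auto simp: J_def)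
        then show ?thesis
          using J(2) sesq_hermitian_real[OF herm, of v]
          unfolding colW by (auto simp: vw wv ww d b_def \<beta>_def)
      qed
      ultimately show ?thesis by blast
    qed
  qed
  then show thesis using that by blast
qed

section \<open>Determinants under congruence and positive definite forms\<close>

lemma fdet_mult: "fdet n (\<lambda>i j. \<Sum>k = 0..<n. F i k * G k j) = fdet n F * fdet n G"
proof -
  have "fdet n F * fdet n G = det (mat n n (\<lambda>(i, j). F i j) * mat n n (\<lambda>(i, j). G i j))"
    unfolding fdet_def by (rule det_mult[of _ n, symmetric]) simp_all
  also have "\<dots> = fdet n (\<lambda>i j. \<Sum>k = 0..<n. F i k * G k j)"
    unfolding fdet_def by (rule arg_cong[of _ _ det]) (auto simp: scalar_prod_def)
  finally show ?thesis by simp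
qed

lemma fdet_transpose: "fdet n (\<lambda>i j. F j i) = fdet n F"
proof -
  have "fdet n (\<lambda>i j. F j i) = det (transpose_mat (mat n n (\<lambda>(i, j). F i j)))"
    unfolding fdet_def by (rule arg_cong[of _ _ det]) auto
  then show ?thesis by (simp add: fdet_def det_transpose[of _ n])
qed

lemma fdet_cnj: "fdet n (\<lambda>i j. cnj (F i j)) = cnj (fdet n F)"
  by (simp add: fdet_leibniz sign_def)

lemma fdet_scale_rows: "fdet n (\<lambda>i j. r i * F i j) = (\<Prod>i = 0..<n. r i) * fdet n F"
  by (simp add: fdet_leibniz prod.distrib sum_distrib_left mult_ac)

lemma fdet_diag: "fdet n (\<lambda>i j. if i = j then d i else 0) = (\<Prod>i = 0..<n. d i)"
proof -
  have "fdet n (\<lambda>i j. if i = j then 1 else (0 :: 'a :: comm_ring_1)) = det (1\<^sub>m n :: 'a mat)"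
    unfolding fdet_def by (rule arg_cong[of _ _ det]) (auto simp: one_mat_def)
  moreover have "fdet n (\<lambda>i j. if i = j then d i else 0) =
      fdet n (\<lambda>i j. d i * (if i = j then 1 else 0))"
    by (rule fdet_cong) simp
  ultimately show ?thesis by (simp add: fdet_scale_rows)
qed

text \<open>The entries are those of the adjoint of \<open>W\<close> times \<open>M\<close> times
  \<open>W\<close>, so the two outer determinants are conjugate to each other.\<close>

lemma fdet_congruence:
  "fdet n (\<lambda>i j. sesq {0..<n} M (\<lambda>k. W k i) (\<lambda>k. W k j)) =
    of_real ((cmod (fdet n W))\<^sup>2) * fdet n M"
proof -
  have "fdet n (\<lambda>i j. sesq {0..<n} M (\<lambda>k. W k i) (\<lambda>k. W k j)) =
      fdet n (\<lambda>i j. \<Sum>k = 0..<n. cnj (W k i) * (\<Sum>l = 0..<n. M k l * W l j))"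
    by (simp add: sesq_def sum_distrib_left mult_ac)
  also have "\<dots> = cnj (fdet n W) * (fdet n M * fdet n W)"
    unfolding fdet_mult fdet_cnj fdet_transpose[of n W] by simp
  finally show ?thesis using complex_norm_square[of "fdet n W"] by (simp add: mult_ac)
qed

lemma fdet_hermitian_real:
  assumes "hermitian_on {0..<n} M"
  shows "fdet n M \<in> \<real>"
proof -
  have "cnj (fdet n M) = fdet n (\<lambda>i j. cnj (M i j))" by (rule fdet_cnj[symmetric])
  also have "\<dots> = fdet n (\<lambda>i j. M j i)"
    by (rule fdet_cong) (use assms in \<open>auto simp: hermitian_on_def\<close>)
  also have "\<dots> = fdet n M" by (rule fdet_transpose)
  finally show ?thesis by (simp add: Reals_cnj_iff)
qed

lemma fdet_neq_0_if_inj: 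
  assumes "inj_on_vectors {0..<n} W"
  shows "fdet n W \<noteq> 0"
proof
  assume "fdet n W = 0"
  then obtain x where x: "\<exists>i<n. x i \<noteq> 0" "\<And>i. i < n \<Longrightarrow> (\<Sum>j = 0..<n. W i j * x j) = 0"
    by (rule fdet_eq_0_imp_kernel) blast
  have "\<forall>i\<in>{0..<n}. (\<Sum>j = 0..<n. W i j * x j) = 0" using x(2) by simp
  then have "\<forall>j\<in>{0..<n}. x j = 0" using assms unfolding inj_on_vectors_def by blast
  then show False using x(1) by auto
qed

definition pos_def_on :: "nat set \<Rightarrow> (nat \<Rightarrow> nat \<Rightarrow> complex) \<Rightarrow> bool" where
  "pos_def_on I M \<longleftrightarrow>
     hermitian_on I M \<and> (\<forall>v. (\<exists>i\<in>I. v i \<noteq> 0) \<longrightarrow> Re (sesq I M v v) > 0)"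

lemma pos_def_onD: "pos_def_on I M \<Longrightarrow> \<exists>i\<in>I. v i \<noteq> 0 \<Longrightarrow> Re (sesq I M v v) > 0"
  by (simp add: pos_def_on_def)

lemma hermitian_on_sign_flip: "hermitian_on I M \<Longrightarrow> hermitian_on I (sign_flip T M)"
  by (auto simp: hermitian_on_def sign_flip_def sgn_on_def)

lemma pos_def_on_sign_flip:
  assumes "pos_def_on I M"
  shows "pos_def_on I (sign_flip T M)"
  using assms hermitian_on_sign_flip
  unfolding pos_def_on_def sesq_sign_flip by (auto simp: sgn_on_def)

text \<open>The new form at \<open>v\<close> is the old one at \<open>W v\<close>, which is nonzero
  because \<open>W\<close> is injective.\<close>

lemma pos_def_on_congruence:
  assumes M: "pos_def_on I M" and W: "inj_on_vectors I W"
  shows "pos_def_on I (\<lambda>i j. sesq I M (\<lambda>k. W k i) (\<lambda>k. W k j))"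
proof -
  have herm: "hermitian_on I M" using M by (simp add: pos_def_on_def)
  have eq: "sesq I (\<lambda>i j. sesq I M (\<lambda>k. W k i) (\<lambda>k. W k j)) v v =
      sesq I M (\<lambda>k. \<Sum>i\<in>I. v i * W k i) (\<lambda>k. \<Sum>i\<in>I. v i * W k i)" for v
  proof -
    have "sesq I M (\<lambda>k. \<Sum>i\<in>I. v i * W k i) (\<lambda>k. \<Sum>i\<in>I. v i * W k i) =
        (\<Sum>i\<in>I. cnj (v i) * (\<Sum>j\<in>I. v j * sesq I M (\<lambda>k. W k i) (\<lambda>k. W k j)))"
      by (subst sesq_sum_left[OF herm, where A = I and c = v and x = "\<lambda>i k. W k i"])
        (simp only: sesq_sum_right sesq_scale_right)
    then show ?thesis by (simp add: sesq_def[of I "\<lambda>i j. sesq I M (\<lambda>k. W k i) (\<lambda>k. W k j)"]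
        sum_distrib_left mult_ac)
  qed
  have nonzero: "\<exists>k\<in>I. (\<Sum>i\<in>I. v i * W k i) \<noteq> 0" if "\<exists>i\<in>I. v i \<noteq> 0" for v
    using W that unfolding inj_on_vectors_def by (auto simp: mult.commute)
  show ?thesis
    unfolding pos_def_on_def eq
    using M nonzero sesq_hermitian[OF herm] by (auto simp: pos_def_on_def hermitian_on_def)
qed

text \<open>In a diagonalizing basis each \<open>b i\<close> is the value of the form at a column of
  \<open>W\<close>. Injectivity, tested on a unit vector, shows that the column is nonzero, so
  \<open>b i > 0\<close>.\<close>

lemma fdet_pos_def:
  assumes M: "pos_def_on {0..<n} M"
  shows "fdet n M \<in> \<real>" "Re (fdet n M) > 0"
proof -
  have herm: "hermitian_on {0..<n} M" using M by (simp add: pos_def_on_def)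
  then show real: "fdet n M \<in> \<real>" by (rule fdet_hermitian_real)
  obtain W b where W: "inj_on_vectors {0..<n} W"
    and b: "\<And>i j. i \<in> {0..<n} \<Longrightarrow> j \<in> {0..<n} \<Longrightarrow>
      sesq {0..<n} M (\<lambda>k. W k i) (\<lambda>k. W k j) = (if i = j then of_real (b i) else 0)"
    using hermitian_congruent_diagonal[OF finite_atLeastLessThan herm] by metis
  have b_pos: "b i > 0" if i: "i < n" for i
  proof -
    have "\<exists>k\<in>{0..<n}. W k i \<noteq> 0"
    proof (rule ccontr)
      assume "\<not> ?thesis"
      then have "\<forall>k\<in>{0..<n}. (\<Sum>j\<in>{0..<n}. W k j * of_bool (j = i)) = 0"
        by (auto intro!: sum.neutral)
      then have "\<forall>j\<in>{0..<n}. of_bool (j = i) = (0 :: complex)"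
        by (rule W[unfolded inj_on_vectors_def, THEN spec[of _ "\<lambda>j. of_bool (j = i)"], THEN mp])
      then show False using i by auto
    qed
    then have "Re (sesq {0..<n} M (\<lambda>k. W k i) (\<lambda>k. W k i)) > 0"
      by (rule pos_def_onD[OF M])
    then show ?thesis using b[of i i] i by simp
  qed
  have "of_real ((cmod (fdet n W))\<^sup>2) * fdet n M =
      fdet n (\<lambda>i j. if i = j then of_real (b i) else 0)"
    unfolding fdet_congruence[symmetric] by (rule fdet_cong) (simp add: b)
  also have "\<dots> = of_real (\<Prod>i = 0..<n. b i)" by (simp add: fdet_diag)
  finally have "of_real ((cmod (fdet n W))\<^sup>2) * fdet n M = of_real (\<Prod>i = 0..<n. b i)" .
  then have "Re (of_real ((cmod (fdet n W))\<^sup>2) * fdet n M) = (\<Prod>i = 0..<n. b i)"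
    by (metis Re_complex_of_real)
  moreover have "(\<Prod>i = 0..<n. b i) > 0" using b_pos by (intro prod_pos) auto
  ultimately have "(cmod (fdet n W))\<^sup>2 * Re (fdet n M) > 0" by simp
  then show "Re (fdet n M) > 0"
    by (simp add: zero_less_mult_iff)
qed

text \<open>The form splits into that of \<open>M\<close> on the part of \<open>v\<close> inside
  \<open>S\<close> and the squared norm of the rest. Since the determinant of this matrix is a
  principal minor of \<open>M\<close>, \<open>fdet_pos_def\<close> then gives positive principal
  minors.\<close>

lemma pos_def_on_block_one:
  assumes M: "pos_def_on I M" and fin: "finite I"
  shows "pos_def_on I (block_entry S M (\<lambda>i j. if i = j then 1 else 0))"
proof -
  let ?B = "block_entry S M (\<lambda>i j. if i = j then 1 else 0)"
  have "Re (sesq I ?B v v) > 0" if v: "\<exists>i\<in>I. v i \<noteq> 0" for v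
  proof -
    define a where "a i = (if i \<in> S then v i else 0)" for i
    have "sesq I ?B v v = sesq I M a a +
        (\<Sum>i\<in>I. \<Sum>j\<in>I. if j = i then if i \<in> S then 0 else cnj (v i) * v i else 0)"
      unfolding sesq_def sum.distrib[symmetric]
      by (intro sum.cong refl) (auto simp: block_entry_def a_def)
    also have "(\<Sum>i\<in>I. \<Sum>j\<in>I. if j = i then if i \<in> S then 0 else cnj (v i) * v i else 0) =
        (\<Sum>i\<in>I. of_real (if i \<in> S then 0 else (cmod (v i))\<^sup>2))"
      using fin complex_norm_square[of "v _"]
      by (intro sum.cong refl) (simp add: sum.delta mult.commute)
    finally have eq: "Re (sesq I ?B v v) =
        Re (sesq I M a a) + (\<Sum>i\<in>I. if i \<in> S then 0 else (cmod (v i))\<^sup>2)" by simp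
    have nonneg: "(\<Sum>i\<in>I. if i \<in> S then 0 else (cmod (v i))\<^sup>2) \<ge> 0"
      by (rule sum_nonneg) simp
    show ?thesis
    proof (cases "\<exists>i\<in>I. a i \<noteq> 0")
      case True
      then have "Re (sesq I M a a) > 0" by (rule pos_def_onD[OF M])
      then show ?thesis using eq nonneg by linarith
    next
      case False
      then have "sesq I M a a = 0" by (intro sesq_zero) blast
      moreover obtain i where "i \<in> I" "i \<notin> S" "v i \<noteq> 0"
        using v False by (auto simp: a_def split: if_splits)
      then have "(\<Sum>i\<in>I. if i \<in> S then 0 else (cmod (v i))\<^sup>2) > 0"
        by (intro sum_pos2[OF fin]) auto
      ultimately show ?thesis using eq by simp
    qed
  qed
  moreover have "hermitian_on I ?B"
    using M by (auto simp: pos_def_on_def hermitian_on_def block_entry_def)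
  ultimately show ?thesis by (simp add: pos_def_on_def)
qed

lemma fdet_sign_flip: "fdet n (sign_flip T F) = fdet n (F :: nat \<Rightarrow> nat \<Rightarrow> 'a :: comm_ring_1)"
proof -
  let ?s = "\<Prod>i = 0..<n. sgn_on T i :: 'a"
  have "fdet n (sign_flip T F) = fdet n (\<lambda>i j. sgn_on T i * (sgn_on T j * F i j))"
    by (rule fdet_cong) (simp add: sign_flip_def mult_ac)
  also have "\<dots> = ?s * fdet n (\<lambda>i j. sgn_on T j * F i j)"
    by (rule fdet_scale_rows)
  also have "\<dots> = ?s * (?s * fdet n F)"
    unfolding fdet_transpose[of n "\<lambda>i j. sgn_on T i * F j i"] fdet_scale_rows
      fdet_transpose[of n F] ..
  also have "?s * (?s * fdet n F) = (\<Prod>i = 0..<n. sgn_on T i * sgn_on T i) * fdet n F"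
    by (simp add: prod.distrib mult.assoc)
  also have "(\<Prod>i = 0..<n. sgn_on T i * sgn_on T i :: 'a) = 1"
    by (rule prod.neutral) (simp add: sgn_on_def)
  finally show ?thesis by simp
qed

text \<open>If all summands of the sign average agree, the factor \<open>2 ^ n\<close> cancels and
  the sum of products of minors collapses to one determinant.\<close>

lemma sum_block_if_flip_invariant:
  fixes F G :: "nat \<Rightarrow> nat \<Rightarrow> complex"
  assumes "\<And>T. fdet n (\<lambda>i j. sign_flip T F i j + G i j) = fdet n (\<lambda>i j. F i j + G i j)"
  shows "(\<Sum>S\<in>Pow {0..<n}. fdet n (block_entry S F G)) = fdet n (\<lambda>i j. F i j + G i j)"
  using sum_fdet_sign_flip[where n = n and F = F and G = G]
  by (simp add: assms card_Pow)

text \<open>Expansion in principal minors of \<open>F\<close>. Sign conjugation fixes a diagonal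
  matrix, so each summand of the sign average is the determinant of a conjugate of the same
  matrix.\<close>

lemma fdet_add_diagonal:
  fixes F :: "nat \<Rightarrow> nat \<Rightarrow> complex"
  shows "fdet n (\<lambda>i j. F i j + (if i = j then d i else 0)) =
    (\<Sum>S\<in>Pow {0..<n}. (\<Prod>i\<in>{0..<n} - S. d i) * fdet n (block_entry S F (\<lambda>i j. if i = j then 1 else 0)))"
proof -
  have "fdet n (\<lambda>i j. sign_flip T F i j + (if i = j then d i else 0)) =
      fdet n (\<lambda>i j. F i j + (if i = j then d i else 0))" for T
  proof -
    have "(\<lambda>i j. sign_flip T F i j + (if i = j then d i else 0)) =
        sign_flip T (\<lambda>i j. F i j + (if i = j then d i else 0))"
      by (intro ext) (simp add: sign_flip_def sgn_on_def algebra_simps)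
    then show ?thesis by (simp only: fdet_sign_flip)
  qed
  then have "fdet n (\<lambda>i j. F i j + (if i = j then d i else 0)) =
      (\<Sum>S\<in>Pow {0..<n}. fdet n (block_entry S F (\<lambda>i j. if i = j then d i else 0)))"
    by (rule sum_block_if_flip_invariant[symmetric])
  also have "\<dots> = (\<Sum>S\<in>Pow {0..<n}. (\<Prod>i\<in>{0..<n} - S. d i) *
      fdet n (block_entry S F (\<lambda>i j. if i = j then 1 else 0)))"
  proof (rule sum.cong[OF refl])
    fix S assume "S \<in> Pow {0..<n}"
    then have S: "S \<subseteq> {0..<n}" by simp
    have "fdet n (block_entry S F (\<lambda>i j. if i = j then d i else 0)) =
        fdet n (\<lambda>i j. (if i \<in> S then 1 else d i) * block_entry S F (\<lambda>i j. if i = j then 1 else 0) i j)"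
      by (rule fdet_cong) (simp add: block_entry_def)
    also have "\<dots> = (\<Prod>i = 0..<n. if i \<in> S then 1 else d i) *
        fdet n (block_entry S F (\<lambda>i j. if i = j then 1 else 0))"
      by (rule fdet_scale_rows)
    also have "(\<Prod>i = 0..<n. if i \<in> S then 1 else d i) = (\<Prod>i\<in>{0..<n} - S. d i)"
      by (rule prod.mono_neutral_cong_right) auto
    finally show "fdet n (block_entry S F (\<lambda>i j. if i = j then d i else 0)) =
        (\<Prod>i\<in>{0..<n} - S. d i) * fdet n (block_entry S F (\<lambda>i j. if i = j then 1 else 0))" .
  qed
  finally show ?thesis .
qed

section \<open>The pencil polynomial\<close>

lemma poly_fdet: "poly (fdet n F) w = fdet n (\<lambda>i j. poly (F i j) w)"
  by (simp add: fdet_leibniz poly_sum poly_prod sign_def)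

text \<open>This is \<open>eta (z A) (- B)\<close> sorted by powers of \<open>z\<close>, with
  complex determinants as coefficients, so that degree, reality and continuity can be read
  off.\<close>

definition pencil_poly :: "nat \<Rightarrow> (nat \<Rightarrow> nat \<Rightarrow> complex) \<Rightarrow> (nat \<Rightarrow> nat \<Rightarrow> complex) \<Rightarrow> complex poly"
  where "pencil_poly n A B =
    (\<Sum>S\<in>Pow {0..<n}. monom (fdet n (block_entry S A (\<lambda>i j. - B i j))) (card S))"

lemma fdet_block_scale:
  assumes S: "S \<subseteq> {0..<n}"
  shows "fdet n (block_entry S (\<lambda>i j. w * F i j) G) = w ^ card S * fdet n (block_entry S F G)"
proof -
  have "fdet n (block_entry S (\<lambda>i j. w * F i j) G) =
      fdet n (\<lambda>i j. (if i \<in> S then w else 1) * block_entry S F G i j)"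
    by (rule fdet_cong) (simp add: block_entry_def)
  also have "\<dots> = (\<Prod>i = 0..<n. if i \<in> S then w else 1) * fdet n (block_entry S F G)"
    by (rule fdet_scale_rows)
  also have "(\<Prod>i = 0..<n. if i \<in> S then w else 1) = (\<Prod>i\<in>S. w)"
    by (rule prod.mono_neutral_cong_right) (use S in auto)
  finally show ?thesis by simp
qed

lemma poly_pencil_poly:
  "poly (pencil_poly n A B) w =
    (\<Sum>S\<in>Pow {0..<n}. fdet n (block_entry S (\<lambda>i j. w * A i j) (\<lambda>i j. - B i j)))"
  unfolding pencil_poly_def poly_sum poly_monom
  by (rule sum.cong) (simp_all add: fdet_block_scale)

lemma poly_pencil_poly_flip_sum:
  "2 ^ n * poly (pencil_poly n A B) w =
    flip_sum n {0..<n} (\<lambda>i j. w * A i j) (\<lambda>i j. - B i j)"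
  unfolding poly_pencil_poly flip_sum_def by (rule sum_fdet_sign_flip[symmetric])

lemma eta_eq_pencil_poly:
  assumes A: "A \<in> carrier_mat n n" and B: "B \<in> carrier_mat n n"
  shows "eta (z_times A) (- const_mat B) =
    pencil_poly n (\<lambda>i j. A $$ (i, j)) (\<lambda>i j. B $$ (i, j))"
proof (rule poly_ext)
  fix w
  have zA: "z_times A \<in> carrier_mat n n" and cB: "- const_mat B \<in> carrier_mat n n"
    using A B by (simp_all add: z_times_def const_mat_def)
  show "poly (eta (z_times A) (- const_mat B)) w =
      poly (pencil_poly n (\<lambda>i j. A $$ (i, j)) (\<lambda>i j. B $$ (i, j))) w"
    unfolding eta_eq_sum_fdet[OF zA cB] poly_pencil_poly poly_sum poly_fdet
    by (intro sum.cong refl fdet_cong)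
      (use A B in \<open>simp add: block_entry_def z_times_def const_mat_def\<close>)
qed

lemma im_nonneg_hermitian: "hermitian_on I B \<Longrightarrow> im_nonneg I (\<lambda>i j. - B i j)"
proof -
  assume "hermitian_on I B"
  then have "hermitian_on I (\<lambda>i j. - B i j)" by (simp add: hermitian_on_def)
  then show ?thesis
    unfolding im_nonneg_def using sesq_hermitian_real by (metis Im_complex_of_real order_refl)
qed

lemma sesq_scale: "sesq I (\<lambda>i j. w * M i j) x y = w * sesq I M x y"
  by (simp add: sesq_def sum_distrib_left mult_ac)

lemma im_pos_scale:
  assumes A: "pos_def_on I A" and w: "Im w > 0"
  shows "im_pos I (\<lambda>i j. w * A i j)"
  unfolding im_pos_def sesq_scale
proof (intro allI impI)
  fix v :: "nat \<Rightarrow> complex" assume "\<exists>i\<in>I. v i \<noteq> 0"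
  then have "Re (sesq I A v v) > 0" by (rule pos_def_onD[OF A])
  moreover have "Im (sesq I A v v) = 0"
    using A sesq_hermitian_real[of I A v] unfolding pos_def_on_def
    by (metis Im_complex_of_real)
  ultimately show "Im (w * sesq I A v v) > 0" using w by simp
qed

lemma coeff_pencil_poly:
  "coeff (pencil_poly n A B) k =
    (\<Sum>S\<in>Pow {0..<n}. if card S = k then fdet n (block_entry S A (\<lambda>i j. - B i j)) else 0)"
  by (simp add: pencil_poly_def coeff_sum)

lemma coeff_pencil_poly_real:
  assumes "hermitian_on {0..<n} A" "hermitian_on {0..<n} B"
  shows "coeff (pencil_poly n A B) k \<in> \<real>"
proof -
  have "hermitian_on {0..<n} (block_entry S A (\<lambda>i j. - B i j))" for S
    using assms by (simp add: hermitian_on_def block_entry_def)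
  then show ?thesis
    unfolding coeff_pencil_poly by (intro sum_in_Reals) (simp add: fdet_hermitian_real)
qed

text \<open>The full index set is the only one with \<open>n\<close> elements, so the coefficient at
  \<open>n\<close> is the determinant of \<open>A\<close>.\<close>

lemma degree_pencil_poly:
  assumes "fdet n A \<noteq> 0"
  shows "degree (pencil_poly n A B) = n"
proof (rule antisym)
  show "degree (pencil_poly n A B) \<le> n"
    unfolding pencil_poly_def
  proof (rule degree_sum_le)
    fix S assume "S \<in> Pow {0..<n}"
    then have "card S \<le> n" using card_mono[of "{0..<n}" S] by simp
    then show "degree (monom (fdet n (block_entry S A (\<lambda>i j. - B i j))) (card S)) \<le> n"
      using degree_monom_le order_trans by blast
  qed simp
  have "coeff (pencil_poly n A B) n =
      (\<Sum>S\<in>Pow {0..<n}. if S = {0..<n} then fdet n A else 0)"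
    unfolding coeff_pencil_poly
  proof (rule sum.cong[OF refl])
    fix S assume S: "S \<in> Pow {0..<n}"
    have "card S = n \<longleftrightarrow> S = {0..<n}"
      using S card_subset_eq[of "{0..<n}" S] by auto
    moreover have "fdet n (block_entry {0..<n} A (\<lambda>i j. - B i j)) = fdet n A"
      by (rule fdet_cong) (simp add: block_entry_def)
    ultimately show "(if card S = n then fdet n (block_entry S A (\<lambda>i j. - B i j)) else 0) =
        (if S = {0..<n} then fdet n A else 0)"
      by simp
  qed
  then have "coeff (pencil_poly n A B) n = fdet n A" by simp
  then show "n \<le> degree (pencil_poly n A B)" using assms by (intro le_degree) simp
qed

text \<open>The upper half-plane is free of roots by \<open>flip_sum_neq_0\<close>, and real
  coefficients reflect this to the lower one.\<close>

lemma hyperbolic_pencil_poly: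
  assumes A: "pos_def_on {0..<n} A" and B: "hermitian_on {0..<n} B"
  shows "hyperbolic (pencil_poly n A B)"
proof -
  let ?p = "pencil_poly n A B"
  have upper: "poly ?p w \<noteq> 0" if "Im w > 0" for w
  proof -
    have "flip_sum n {0..<n} (\<lambda>i j. w * A i j) (\<lambda>i j. - B i j) \<noteq> 0"
      by (rule flip_sum_neq_0) (simp_all add: im_pos_scale[OF A that] im_nonneg_hermitian[OF B])
    then show ?thesis by (simp flip: poly_pencil_poly_flip_sum)
  qed
  have real: "coeff ?p k \<in> \<real>" for k
    using A B by (intro coeff_pencil_poly_real) (simp_all add: pos_def_on_def)
  have "w \<in> \<real>" if w: "poly ?p w = 0" for w
  proof -
    have "poly ?p (cnj w) = 0"
      using poly_cnj_real[of ?p w] real w by simp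
    then have "\<not> Im w > 0" "\<not> Im (cnj w) > 0" using upper w by blast+
    then show ?thesis by (simp add: complex_is_Real_iff)
  qed
  moreover have "?p \<noteq> 0" using upper[of \<i>] by auto
  ultimately show ?thesis using real by (simp add: hyperbolic_def)
qed

lemma order_0_eqI:
  assumes "\<And>k. k < d \<Longrightarrow> coeff p k = 0" "coeff p d \<noteq> 0"
  shows "order 0 p = d"
proof -
  have p: "p \<noteq> 0" using assms(2) by auto
  have "monom 1 d dvd p" "\<not> monom 1 (Suc d) dvd p"
    using assms unfolding monom_1_dvd_iff' by auto
  then show ?thesis unfolding monom_1_dvd_iff[OF p] by simp
qed

text \<open>After the congruence by \<open>W\<close>, every summand of the sign average has as its lowest nonzero
  coefficient a positive multiple of the product of the nonzero \<open>- b i\<close>, so the lowest terms do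
  not cancel.\<close>

lemma order_0_pencil_poly:
  assumes A: "pos_def_on {0..<n} A" and B: "hermitian_on {0..<n} B"
    and W: "inj_on_vectors {0..<n} W"
    and diag: "\<And>i j. i \<in> {0..<n} \<Longrightarrow> j \<in> {0..<n} \<Longrightarrow>
      sesq {0..<n} B (\<lambda>k. W k i) (\<lambda>k. W k j) = (if i = j then of_real (b i) else 0)"
  shows "order 0 (pencil_poly n A B) = card {i\<in>{0..<n}. b i = 0}"
proof -
  let ?N = "{0..<n}" and ?p = "pencil_poly n A B"
  define Z where "Z = {i\<in>?N. b i = 0}"
  \<comment> \<open>\<open>D T\<close> is the sign conjugate of \<open>A\<close> in the basis that
    diagonalizes \<open>B\<close>; below, \<open>\<mu> S T\<close> is its principal minor on
    \<open>S\<close>, and \<open>\<kappa>\<close> collects the determinant factor of the congruence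
    and the \<open>2 ^ n\<close> of the average.\<close>
  define D where "D T i j = sesq ?N (sign_flip T A) (\<lambda>k. W k i) (\<lambda>k. W k j)" for T i j
  define \<mu> where "\<mu> S T = fdet n (block_entry S (D T) (\<lambda>i j. if i = j then 1 else 0))" for S T
  define \<kappa> where "\<kappa> = complex_of_real ((cmod (fdet n W))\<^sup>2) * 2 ^ n"
  define \<pi> where "\<pi> S = (\<Prod>i\<in>?N - S. - complex_of_real (b i))" for S
  have \<kappa>: "\<kappa> \<noteq> 0" using fdet_neq_0_if_inj[OF W] by (simp add: \<kappa>_def)
  have summand: "of_real ((cmod (fdet n W))\<^sup>2) *
      fdet n (\<lambda>i j. sign_flip T (\<lambda>i j. w * A i j) i j + - B i j) =
      (\<Sum>S\<in>Pow ?N. \<pi> S * (w ^ card S * \<mu> S T))" for T w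
  proof -
    have "of_real ((cmod (fdet n W))\<^sup>2) *
        fdet n (\<lambda>i j. sign_flip T (\<lambda>i j. w * A i j) i j + - B i j) =
        fdet n (\<lambda>i j. sesq ?N (\<lambda>i j. sign_flip T (\<lambda>i j. w * A i j) i j + - B i j)
          (\<lambda>k. W k i) (\<lambda>k. W k j))"
      by (rule fdet_congruence[symmetric])
    also have "\<dots> = fdet n (\<lambda>i j. w * D T i j + (if i = j then - of_real (b i) else 0))"
    proof (rule fdet_cong)
      fix i j assume ij: "i < n" "j < n"
      have "sesq ?N (\<lambda>i j. sign_flip T (\<lambda>i j. w * A i j) i j + - B i j) x y =
          w * sesq ?N (sign_flip T A) x y + (- 1) * sesq ?N B x y" for x y
        unfolding sesq_scale[symmetric] sesq_add_matrix[symmetric]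
        by (simp add: sign_flip_def mult_ac)
      then show "sesq ?N (\<lambda>i j. sign_flip T (\<lambda>i j. w * A i j) i j + - B i j)
          (\<lambda>k. W k i) (\<lambda>k. W k j) = w * D T i j + (if i = j then - of_real (b i) else 0)"
        using ij by (simp add: D_def diag)
    qed
    also have "\<dots> = (\<Sum>S\<in>Pow ?N. \<pi> S *
        fdet n (block_entry S (\<lambda>i j. w * D T i j) (\<lambda>i j. if i = j then 1 else 0)))"
      unfolding \<pi>_def by (rule fdet_add_diagonal)
    also have "\<dots> = (\<Sum>S\<in>Pow ?N. \<pi> S * (w ^ card S * \<mu> S T))"
      by (rule sum.cong) (simp_all add: fdet_block_scale \<mu>_def)
    finally show ?thesis .
  qed
  have "smult \<kappa> ?p = (\<Sum>T\<in>Pow ?N. \<Sum>S\<in>Pow ?N. monom (\<pi> S * \<mu> S T) (card S))"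
  proof (rule poly_ext)
    fix w
    have "poly (smult \<kappa> ?p) w =
        of_real ((cmod (fdet n W))\<^sup>2) * (2 ^ n * poly ?p w)" by (simp add: \<kappa>_def)
    also have "\<dots> = (\<Sum>T\<in>Pow ?N. \<Sum>S\<in>Pow ?N. \<pi> S * (w ^ card S * \<mu> S T))"
      unfolding poly_pencil_poly_flip_sum flip_sum_def sum_distrib_left summand ..
    also have "\<dots> = poly (\<Sum>T\<in>Pow ?N. \<Sum>S\<in>Pow ?N. monom (\<pi> S * \<mu> S T) (card S)) w"
      by (simp add: poly_sum poly_monom mult_ac)
    finally show "poly (smult \<kappa> ?p) w =
        poly (\<Sum>T\<in>Pow ?N. \<Sum>S\<in>Pow ?N. monom (\<pi> S * \<mu> S T) (card S)) w" .
  qed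
  then have coeff: "\<kappa> * coeff ?p k =
      (\<Sum>T\<in>Pow ?N. \<Sum>S\<in>Pow ?N. if card S = k then \<pi> S * \<mu> S T else 0)" for k
    by (simp add: coeff_sum flip: coeff_smult)
  have ZN: "Z \<subseteq> ?N" "finite Z" by (auto simp: Z_def)
  \<comment> \<open>A zero \<open>b i\<close> outside \<open>S\<close> kills \<open>\<pi> S\<close>.
    Hence no power below \<open>card Z\<close> occurs, and the power \<open>card Z\<close> comes
    from \<open>S = Z\<close> alone.\<close>
  have \<pi>0: "\<pi> S = 0" if "\<not> Z \<subseteq> S" for S
  proof -
    obtain i where "i \<in> Z" "i \<notin> S" using \<open>\<not> Z \<subseteq> S\<close> by blast
    then show ?thesis unfolding \<pi>_def by (intro prod_zero) (auto simp: Z_def)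
  qed
  have "order 0 ?p = card Z"
  proof (rule order_0_eqI)
    fix k assume k: "k < card Z"
    have "(if card S = k then \<pi> S * \<mu> S T else 0) = 0" if "S \<in> Pow ?N" for S T
    proof -
      have "finite S" using that finite_subset by auto
      then show ?thesis using k \<pi>0[of S] card_mono[of S Z] by (cases "Z \<subseteq> S") auto
    qed
    then have "\<kappa> * coeff ?p k = 0" unfolding coeff by (intro sum.neutral ballI) auto
    then show "coeff ?p k = 0" using \<kappa> by simp
  next
    have "(if card S = card Z then \<pi> S * \<mu> S T else 0) = (if S = Z then \<pi> Z * \<mu> Z T else 0)"
      if "S \<in> Pow ?N" for S T
    proof -
      have "finite S" using that finite_subset by auto
      then show ?thesis using \<pi>0[of S] card_subset_eq[of S Z] by (cases "Z \<subseteq> S") auto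
    qed
    then have "\<kappa> * coeff ?p (card Z) = (\<Sum>T\<in>Pow ?N. \<Sum>S\<in>Pow ?N. if S = Z then \<pi> Z * \<mu> Z T else 0)"
      unfolding coeff by (intro sum.cong refl) auto
    also have "\<dots> = \<pi> Z * (\<Sum>T\<in>Pow ?N. \<mu> Z T)"
      using ZN by (simp add: sum_distrib_left)
    finally have eq: "\<kappa> * coeff ?p (card Z) = \<pi> Z * (\<Sum>T\<in>Pow ?N. \<mu> Z T)" .
    have "Re (\<mu> Z T) > 0" for T
    proof -
      have "pos_def_on ?N (D T)"
        unfolding D_def[abs_def]
        by (rule pos_def_on_congruence[OF pos_def_on_sign_flip[OF A] W])
      then show ?thesis
        unfolding \<mu>_def by (intro fdet_pos_def pos_def_on_block_one) simp_all
    qed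
    then have "Re (\<Sum>T\<in>Pow ?N. \<mu> Z T) > 0"
      unfolding Re_sum by (intro sum_pos) auto
    then have "(\<Sum>T\<in>Pow ?N. \<mu> Z T) \<noteq> 0"
      by (metis less_irrefl zero_complex.sel(1))
    moreover have "\<pi> Z \<noteq> 0" unfolding \<pi>_def by (auto simp: Z_def)
    ultimately show "coeff ?p (card Z) \<noteq> 0" using eq by auto
  qed
  then show ?thesis by (simp add: Z_def)
qed

text \<open>The diagonalization depends on \<open>B\<close> only, so one choice of \<open>W\<close>
  and \<open>b\<close> serves both matrices.\<close>

lemma order_0_pencil_poly_eq:
  assumes "pos_def_on {0..<n} A" "pos_def_on {0..<n} A'" "hermitian_on {0..<n} B"
  shows "order 0 (pencil_poly n A B) = order 0 (pencil_poly n A' B)"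
proof -
  obtain W b where "inj_on_vectors {0..<n} W"
    "\<And>i j. i \<in> {0..<n} \<Longrightarrow> j \<in> {0..<n} \<Longrightarrow>
      sesq {0..<n} B (\<lambda>k. W k i) (\<lambda>k. W k j) = (if i = j then of_real (b i) else 0)"
    using hermitian_congruent_diagonal[OF finite_atLeastLessThan assms(3)] by metis
  note order = order_0_pencil_poly[OF _ assms(3) this]
  show ?thesis using order[OF assms(1)] order[OF assms(2)] by simp
qed

section \<open>Continuity of real roots\<close>

text \<open>Roots are listed with repetition, so multiplicities become cardinalities of sets of
  indices.\<close>

definition root_product :: "nat \<Rightarrow> (nat \<Rightarrow> real) \<Rightarrow> complex poly" where
  "root_product n x = (\<Prod>i<n. [:- complex_of_real (x i), 1:])"

lemma hyperbolic_factorization: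
  assumes "hyperbolic p"
  obtains x where "p = smult (lead_coeff p) (root_product (degree p) x)"
proof -
  obtain r where r: "smult (lead_coeff p) (\<Prod>i<degree p. [:- r i, 1:]) = p"
    using complex_poly_decompose'[of p] by metis
  have "r i \<in> \<real>" if "i < degree p" for i
  proof -
    have "poly (smult (lead_coeff p) (\<Prod>i<degree p. [:- r i, 1:])) (r i) = 0"
      using that by (auto simp: poly_prod)
    then have "poly p (r i) = 0" unfolding r .
    then show ?thesis using assms by (simp add: hyperbolic_def)
  qed
  then have "root_product (degree p) (\<lambda>i. Re (r i)) = (\<Prod>i<degree p. [:- r i, 1:])"
    unfolding root_product_def by (intro prod.cong refl) simp
  then show thesis using r that by metis
qed

lemma size_filter_sum_singletons:
  fixes n :: nat
  shows "size (filter_mset Q (\<Sum>i<n. {#f i#})) = card {i. i < n \<and> Q (f i)}"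
proof (induction n)
  case (Suc n)
  have "{i. i < Suc n \<and> Q (f i)} =
      (if Q (f n) then insert n {i. i < n \<and> Q (f i)} else {i. i < n \<and> Q (f i)})"
    by (auto simp: less_Suc_eq)
  then show ?case using Suc by simp
qed simp

lemma proots_root_product:
  assumes "c \<noteq> 0"
  shows "proots (smult c (root_product n x)) = (\<Sum>i<n. {#complex_of_real (x i)#})"
  using assms by (simp add: root_product_def proots_prod)

lemma iota_root_product:
  assumes "c \<noteq> 0"
  shows "iota_pos (smult c (root_product n x)) = card {i. i < n \<and> x i > 0}"
    "iota_neg (smult c (root_product n x)) = card {i. i < n \<and> x i < 0}"
    "iota_zero (smult c (root_product n x)) = card {i. i < n \<and> x i = 0}"
proof -
  show "iota_pos (smult c (root_product n x)) = card {i. i < n \<and> x i > 0}"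
    "iota_neg (smult c (root_product n x)) = card {i. i < n \<and> x i < 0}"
    unfolding iota_pos_def iota_neg_def proots_root_product[OF assms] size_filter_sum_singletons
    by simp_all
  have "count (\<Sum>i<n. {#complex_of_real (x i)#}) 0 =
      size (filter_mset (\<lambda>w. w = 0) (\<Sum>i<n. {#complex_of_real (x i)#}))"
    by (simp add: filter_eq_replicate_mset)
  then show "iota_zero (smult c (root_product n x)) = card {i. i < n \<and> x i = 0}"
    unfolding iota_zero_def proots_root_product[OF assms] size_filter_sum_singletons by simp
qed

lemma card_sign_partition:
  fixes x :: "nat \<Rightarrow> real"
  shows "card {i. i < n \<and> x i > 0} + card {i. i < n \<and> x i < 0} + card {i. i < n \<and> x i = 0} = n"
proof -
  have "card {i. i < n \<and> x i > 0} + card {i. i < n \<and> x i < 0} =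
      card ({i. i < n \<and> x i > 0} \<union> {i. i < n \<and> x i < 0})"
    by (rule card_Un_disjoint[symmetric]) auto
  moreover have "\<dots> + card {i. i < n \<and> x i = 0} =
      card (({i. i < n \<and> x i > 0} \<union> {i. i < n \<and> x i < 0}) \<union> {i. i < n \<and> x i = 0})"
    by (rule card_Un_disjoint[symmetric]) auto
  moreover have "({i. i < n \<and> x i > 0} \<union> {i. i < n \<and> x i < 0}) \<union> {i. i < n \<and> x i = 0} = {..<n}"
    by auto
  ultimately show ?thesis by simp
qed

lemma iota_sum_eq_degree:
  assumes "hyperbolic p"
  shows "iota_pos p + iota_neg p + iota_zero p = degree p"
proof -
  obtain x where "p = smult (lead_coeff p) (root_product (degree p) x)"
    using hyperbolic_factorization[OF assms] .
  moreover have "lead_coeff p \<noteq> 0" using assms by (simp add: hyperbolic_def)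
  ultimately show ?thesis
    using iota_root_product[of "lead_coeff p" "degree p" x] card_sign_partition[of "degree p" x]
    by simp
qed

text \<open>If \<open>cmod z > 1\<close>, every lower power of \<open>z\<close> is at most the power
  of exponent \<open>degree p - 1\<close> in modulus; dividing the equation by that power gives the
  bound.\<close>

lemma root_bound:
  fixes p :: "complex poly" and M :: real
  assumes root: "poly p z = 0" and p: "p \<noteq> 0"
    and M: "\<And>k. k < degree p \<Longrightarrow> cmod (coeff p k / lead_coeff p) \<le> M"
  shows "cmod z \<le> max 1 (degree p * M)"
proof (cases "cmod z \<le> 1")
  case False
  define n where "n = degree p"
  have "n \<noteq> 0" using root p by (auto simp: n_def elim!: degree_eq_zeroE)
  then obtain m where m: "n = Suc m" by (cases n) auto
  have "0 = (\<Sum>k\<le>n. coeff p k * z ^ k) / lead_coeff p"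
    using root by (simp add: poly_altdef n_def)
  also have "\<dots> = z ^ n + (\<Sum>k<n. coeff p k / lead_coeff p * z ^ k)"
    using p by (simp add: n_def lessThan_Suc_atMost[symmetric] add_divide_distrib sum_divide_distrib)
  finally have "z ^ n = - (\<Sum>k<n. coeff p k / lead_coeff p * z ^ k)"
    by (simp add: eq_neg_iff_add_eq_0)
  then have "cmod z ^ n = cmod (\<Sum>k<n. coeff p k / lead_coeff p * z ^ k)"
    by (metis norm_minus_cancel norm_power)
  also have "\<dots> \<le> (\<Sum>k<n. M * cmod z ^ m)"
  proof (rule sum_norm_le)
    fix k assume k: "k \<in> {..<n}"
    have "cmod (coeff p k / lead_coeff p * z ^ k) = cmod (coeff p k / lead_coeff p) * cmod z ^ k"
      by (simp add: norm_mult norm_power norm_divide)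
    also have "\<dots> \<le> M * cmod z ^ m"
      using k False M[of k] m
      by (intro mult_mono power_increasing) (auto simp: n_def intro: order_trans[OF norm_ge_zero])
    finally show "cmod (coeff p k / lead_coeff p * z ^ k) \<le> M * cmod z ^ m" .
  qed
  finally have "cmod z * cmod z ^ m \<le> (n * M) * cmod z ^ m" by (simp add: m algebra_simps)
  moreover have "cmod z ^ m > 0" using False by (intro zero_less_power) linarith
  ultimately have "cmod z \<le> n * M" by (rule mult_right_le_imp_le)
  then show ?thesis by (simp add: n_def)
qed simp

text \<open>Bolzano-Weierstrass for one coordinate after another, each time passing to a further
  subsequence.\<close>

lemma bounded_family_subsequence:
  fixes x :: "nat \<Rightarrow> nat \<Rightarrow> real"
  assumes "\<And>i. i < n \<Longrightarrow> Bseq (\<lambda>j. x j i)"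
  shows "\<exists>r y. strict_mono r \<and> (\<forall>i<n. (\<lambda>j. x (r j) i) \<longlonglongrightarrow> y i)"
  using assms
proof (induction n)
  case 0
  show ?case using strict_mono_id by auto
next
  case (Suc n)
  then obtain r y where r: "strict_mono r" and y: "\<forall>i<n. (\<lambda>j. x (r j) i) \<longlonglongrightarrow> y i"
    by fastforce
  obtain s where s: "strict_mono s" "monoseq (\<lambda>j. x (r (s j)) n)"
    using seq_monosub[of "\<lambda>j. x (r j) n"] by auto
  have "Bseq (\<lambda>j. x (r (s j)) n)"
    using Suc.prems[of n] by (auto simp: Bseq_def)
  then obtain l where l: "(\<lambda>j. x (r (s j)) n) \<longlonglongrightarrow> l"
    using Bseq_monoseq_convergent[OF _ s(2)] by (auto simp: convergent_def)
  have "(\<lambda>j. x (r (s j)) i) \<longlonglongrightarrow> y i" if "i < n" for i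
    using LIMSEQ_subseq_LIMSEQ[OF _ s(1), of "\<lambda>j. x (r j) i"] y that by (simp add: o_def)
  then have "\<forall>i<Suc n. (\<lambda>j. x (r (s j)) i) \<longlonglongrightarrow> (y(n := l)) i"
    using l by (auto simp: less_Suc_eq)
  moreover have "strict_mono (\<lambda>j. r (s j))"
    using strict_mono_o[OF r s(1)] by (simp add: o_def)
  ultimately show ?case by (intro exI[of _ "\<lambda>j. r (s j)"] exI[of _ "y(n := l)"]) simp
qed

text \<open>Along a subsequence the roots converge; nonzero limits keep their sign, and since the number
  of zero roots does not change, the numbers of positive and of negative roots do not either.\<close>

lemma iota_pos_limit:
  assumes P: "\<And>j. hyperbolic (P j)" "\<And>j. degree (P j) = n"
    and q: "hyperbolic q" "degree q = n"
    and conv: "\<And>k. (\<lambda>j. coeff (P j) k) \<longlonglongrightarrow> coeff q k"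
    and zero: "\<And>j. iota_zero (P j) = iota_zero q"
  shows "\<exists>j. iota_pos (P j) = iota_pos q"
proof -
  have lead: "coeff (P j) n \<noteq> 0" "coeff q n \<noteq> 0" for j
    using P(1)[of j] P(2)[of j] q leading_coeff_0_iff[of "P j"] leading_coeff_0_iff[of q]
    by (auto simp: hyperbolic_def)
  have "\<exists>x. P j = smult (coeff (P j) n) (root_product n x)" for j
    using hyperbolic_factorization[OF P(1)] P(2) by metis
  \<comment> \<open>For each \<open>j\<close> the roots come in an arbitrary order; compactness
    makes up for the missing continuous choice.\<close>
  then obtain x where x: "P j = smult (coeff (P j) n) (root_product n (x j))" for j
    by metis
  have "(\<lambda>j. coeff (P j) k / coeff (P j) n) \<longlonglongrightarrow> coeff q k / coeff q n" for k
    by (intro tendsto_divide conv lead)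
  then have "Bseq (\<lambda>j. coeff (P j) k / coeff (P j) n)" for k
    using convergent_imp_Bseq convergent_def by blast
  then have "\<forall>k. \<exists>K. \<forall>j. cmod (coeff (P j) k / coeff (P j) n) \<le> K"
    unfolding Bseq_def by blast
  then obtain K where K: "cmod (coeff (P j) k / coeff (P j) n) \<le> K k" for j k by metis
  define M where "M = (\<Sum>k<n. K k)"
  have K_nonneg: "0 \<le> K k" for k using K[of 0 k] norm_ge_zero order_trans by blast
  have M: "cmod (coeff (P j) k / coeff (P j) n) \<le> M" if "k < n" for j k
    using K[of j k] member_le_sum[of k "{..<n}" K] that K_nonneg by (simp add: M_def)
  have bound: "\<bar>x j i\<bar> \<le> max 1 (n * M)" if "i < n" for i j
  proof -
    have "poly (smult (coeff (P j) n) (root_product n (x j))) (x j i) = 0"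
      using that by (auto simp: root_product_def poly_prod)
    then have "poly (P j) (x j i) = 0" using x[of j] by metis
    then have "cmod (x j i) \<le> max 1 (degree (P j) * M)"
      by (rule root_bound) (use P(1)[of j] P(2)[of j] M[of _ j] in \<open>auto simp: hyperbolic_def\<close>)
    then show ?thesis by (simp add: P(2))
  qed
  have "Bseq (\<lambda>j. x j i)" if "i < n" for i
    using bound[OF that] by (intro BseqI') simp
  then obtain r y where r: "strict_mono r" and y: "\<And>i. i < n \<Longrightarrow> (\<lambda>j. x (r j) i) \<longlonglongrightarrow> y i"
    using bounded_family_subsequence[of n x] by blast
  have conv_r: "(\<lambda>j. coeff (P (r j)) k) \<longlonglongrightarrow> coeff q k" for k
    using LIMSEQ_subseq_LIMSEQ[OF conv r] by (simp add: o_def)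
  \<comment> \<open>At every point both the expanded and the factored form of \<open>P (r j)\<close>
    converge, so the limits \<open>y\<close> are the roots of \<open>q\<close> with
    multiplicity.\<close>
  have "q = smult (coeff q n) (root_product n y)"
  proof (rule poly_ext)
    fix w
    have "(\<lambda>j. \<Sum>k\<le>n. coeff (P (r j)) k * w ^ k) \<longlonglongrightarrow> (\<Sum>k\<le>n. coeff q k * w ^ k)"
      by (intro tendsto_intros conv_r)
    then have "(\<lambda>j. poly (P (r j)) w) \<longlonglongrightarrow> poly q w"
      by (simp add: poly_altdef P(2) q(2))
    moreover have "(\<lambda>j. poly (P (r j)) w) \<longlonglongrightarrow> poly (smult (coeff q n) (root_product n y)) w"
    proof -
      have "poly (P j) w = coeff (P j) n * (\<Prod>i<n. w - x j i)" for j
        by (subst x) (simp add: root_product_def poly_prod)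
      moreover have "(\<lambda>j. coeff (P (r j)) n * (\<Prod>i<n. w - x (r j) i)) \<longlonglongrightarrow>
          coeff q n * (\<Prod>i<n. w - y i)"
        by (intro tendsto_intros conv_r y) simp
      ultimately show ?thesis by (simp add: root_product_def poly_prod)
    qed
    ultimately show "poly q w = poly (smult (coeff q n) (root_product n y)) w"
      by (rule LIMSEQ_unique)
  qed
  note q_iota = iota_root_product[OF lead(2), of n y, folded this]
  have P_iota: "iota_pos (P j) = card {i. i < n \<and> x j i > 0}"
    "iota_zero (P j) = card {i. i < n \<and> x j i = 0}" for j
    using iota_root_product[OF lead(1)[of j], of n "x j"] x[of j] by simp_all
  have "\<forall>\<^sub>F j in sequentially. \<forall>i\<in>{..<n}. (y i > 0 \<longrightarrow> x (r j) i > 0) \<and> (y i < 0 \<longrightarrow> x (r j) i < 0)"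
    using y order_tendstoD
    by (intro eventually_ball_finite ballI eventually_conj) (fastforce elim: eventually_mono)+
  then obtain j where j: "\<And>i. i < n \<Longrightarrow> y i > 0 \<Longrightarrow> x (r j) i > 0"
    "\<And>i. i < n \<Longrightarrow> y i < 0 \<Longrightarrow> x (r j) i < 0"
    by (auto dest!: eventually_happens)
  have "card {i. i < n \<and> y i > 0} \<le> card {i. i < n \<and> x (r j) i > 0}"
    by (rule card_mono) (use j in auto)
  moreover have "card {i. i < n \<and> y i < 0} \<le> card {i. i < n \<and> x (r j) i < 0}"
    by (rule card_mono) (use j in auto)
  moreover have "card {i. i < n \<and> x (r j) i = 0} = card {i. i < n \<and> y i = 0}"
    using zero[of "r j"] by (simp add: P_iota q_iota)
  ultimately have "card {i. i < n \<and> x (r j) i > 0} = card {i. i < n \<and> y i > 0}"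
    using card_sign_partition[of n y] card_sign_partition[of n "x (r j)"] by linarith
  then show ?thesis using P_iota q_iota by metis
qed

text \<open>A locally constant function on a connected interval is constant. If local constancy
  failed at \<open>a\<close>, some sequence tending to \<open>a\<close> would have counts all
  different from the one at \<open>a\<close>; a single index of agreement, as
  \<open>iota_pos_limit\<close> provides, refutes this.\<close>

lemma iota_pos_path:
  fixes P :: "real \<Rightarrow> complex poly"
  assumes P: "\<And>t. t \<in> {0..1} \<Longrightarrow> hyperbolic (P t)" "\<And>t. t \<in> {0..1} \<Longrightarrow> degree (P t) = n"
    and zero: "\<And>t. t \<in> {0..1} \<Longrightarrow> iota_zero (P t) = d"
    and cont: "\<And>k. continuous_on {0..1} (\<lambda>t. coeff (P t) k)"
  shows "iota_pos (P 0) = iota_pos (P 1)"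
proof (rule connected_local_const[where A = "{0..1}" and f = "\<lambda>t. iota_pos (P t)"
      and a = 0 and b = 1])
  show "\<forall>a\<in>{0..1}. \<forall>\<^sub>F b in at a within {0..1}. iota_pos (P a) = iota_pos (P b)"
  proof (rule ballI, rule sequentially_imp_eventually_within, intro allI impI, elim conjE)
    fix a :: real and f :: "nat \<Rightarrow> real"
    assume a: "a \<in> {0..1}" and f: "\<forall>n. f n \<in> {0..1} \<and> f n \<noteq> a" and lim: "f \<longlonglongrightarrow> a"
    show "\<forall>\<^sub>F n in sequentially. iota_pos (P a) = iota_pos (P (f n))"
    proof (rule ccontr)
      assume "\<not> ?thesis"
      then obtain r :: "nat \<Rightarrow> nat" where r: "strict_mono r"
        "\<And>j. iota_pos (P a) \<noteq> iota_pos (P (f (r j)))"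
        using not_eventually_sequentiallyD by blast
      have "(\<lambda>j. f (r j)) \<longlonglongrightarrow> a"
        using LIMSEQ_subseq_LIMSEQ[OF lim r(1)] by (simp add: o_def)
      then have "(\<lambda>j. coeff (P (f (r j))) k) \<longlonglongrightarrow> coeff (P a) k" for k
        using continuous_on_tendsto_compose[OF cont[of k], of "\<lambda>j. f (r j)"] a f by simp
      then have "\<exists>j. iota_pos (P (f (r j))) = iota_pos (P a)"
        using P zero a f by (intro iota_pos_limit[where n = n]) auto
      then show False using r(2) by metis
    qed
  qed
qed simp_all

section \<open>Deformation of the positive definite matrix\<close>

lemma continuous_on_fdet:
  fixes F :: "real \<Rightarrow> nat \<Rightarrow> nat \<Rightarrow> complex"
  assumes "\<And>i j. continuous_on I (\<lambda>t. F t i j)"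
  shows "continuous_on I (\<lambda>t. fdet n (F t))"
  unfolding fdet_leibniz by (intro continuous_intros assms)

lemma pos_def_on_convex:
  assumes A: "pos_def_on I A" and A': "pos_def_on I A'" and t: "t \<in> {0..1}"
  shows "pos_def_on I (\<lambda>i j. of_real (1 - t) * A i j + of_real t * A' i j)"
  unfolding pos_def_on_def
proof (intro conjI allI impI)
  show "hermitian_on I (\<lambda>i j. of_real (1 - t) * A i j + of_real t * A' i j)"
    using A A' by (simp add: pos_def_on_def hermitian_on_def)
  fix v :: "nat \<Rightarrow> complex" assume v: "\<exists>i\<in>I. v i \<noteq> 0"
  have "Re (sesq I A v v) > 0" "Re (sesq I A' v v) > 0"
    using pos_def_onD[OF A v] pos_def_onD[OF A' v] by auto
  then have "(1 - t) * Re (sesq I A v v) + t * Re (sesq I A' v v) > 0"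
    using t by (cases "t = 0") (auto intro: add_nonneg_pos)
  then show "Re (sesq I (\<lambda>i j. of_real (1 - t) * A i j + of_real t * A' i j) v v) > 0"
    by (simp add: sesq_add_matrix sesq_scale)
qed

lemma iota_pencil_poly:
  assumes A: "pos_def_on {0..<n} A" and A': "pos_def_on {0..<n} A'"
    and B: "hermitian_on {0..<n} B"
  shows "iota (pencil_poly n A B) = iota (pencil_poly n A' B)"
proof -
  define C where "C t i j = of_real (1 - t) * A i j + of_real t * A' i j" for t i j
  have C: "pos_def_on {0..<n} (C t)" if "t \<in> {0..1}" for t
    unfolding C_def[abs_def] by (rule pos_def_on_convex[OF A A' that])
  have fdet: "fdet n M \<noteq> 0" if "pos_def_on {0..<n} M" for M
    using fdet_pos_def(2)[OF that] by auto
  have zero: "iota_zero (pencil_poly n M B) = order 0 (pencil_poly n A B)"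
    if M: "pos_def_on {0..<n} M" for M
    using hyperbolic_pencil_poly[OF M B] order_0_pencil_poly_eq[OF M A B]
    by (simp add: iota_zero_def hyperbolic_def)
  have "iota_pos (pencil_poly n (C 0) B) = iota_pos (pencil_poly n (C 1) B)"
  proof (rule iota_pos_path)
    fix t :: real assume t: "t \<in> {0..1}"
    show "hyperbolic (pencil_poly n (C t) B)" by (rule hyperbolic_pencil_poly[OF C[OF t] B])
    show "degree (pencil_poly n (C t) B) = n" by (rule degree_pencil_poly[OF fdet[OF C[OF t]]])
    show "iota_zero (pencil_poly n (C t) B) = order 0 (pencil_poly n A B)" by (rule zero[OF C[OF t]])
  next
    fix k
    have "continuous_on {0..1} (\<lambda>t. block_entry S (C t) (\<lambda>i j. - B i j) i j)" for S i j
      unfolding block_entry_def C_def by (cases "i \<in> S"; cases "j \<in> S") (auto intro!: continuous_intros)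
    then have cont: "continuous_on {0..1} (\<lambda>t. fdet n (block_entry S (C t) (\<lambda>i j. - B i j)))" for S
      by (rule continuous_on_fdet)
    have "continuous_on {0..1} (\<lambda>t. if card S = k
        then fdet n (block_entry S (C t) (\<lambda>i j. - B i j)) else 0)" for S
      using cont[of S] by (cases "card S = k") simp_all
    then show "continuous_on {0..1} (\<lambda>t. coeff (pencil_poly n (C t) B) k)"
      unfolding coeff_pencil_poly by (rule continuous_on_sum)
  qed
  moreover have "C 0 = A" "C 1 = A'" by (simp_all add: C_def fun_eq_iff)
  ultimately have pos: "iota_pos (pencil_poly n A B) = iota_pos (pencil_poly n A' B)" by simp
  \<comment> \<open>The three counts add up to the degree \<open>n\<close>, so the number of
    negative roots follows from the other two.\<close>
  have "iota_pos (pencil_poly n M B) + iota_neg (pencil_poly n M B) + iota_zero (pencil_poly n M B) = n"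
    if M: "pos_def_on {0..<n} M" for M
    using iota_sum_eq_degree[OF hyperbolic_pencil_poly[OF M B]] degree_pencil_poly[OF fdet[OF M]]
    by simp
  then have "iota_neg (pencil_poly n A B) = iota_neg (pencil_poly n A' B)"
    using pos zero A A' by (metis add_left_cancel add_right_cancel)
  then show ?thesis using pos zero A A' by (simp add: iota_def)
qed

section \<open>Transfer to matrices, and the identity matrix\<close>

lemma hermitian_imp_hermitian_on:
  assumes "hermitian A" "A \<in> carrier_mat n n"
  shows "hermitian_on {0..<n} (\<lambda>i j. A $$ (i, j))"
proof -
  have "mat_adjoint A $$ (j, i) = cnj (A $$ (i, j))" if "i < n" "j < n" for i j
    using assms(2) that by (simp add: mat_adjoint_def mat_of_rows_index)
  moreover have "mat_adjoint A = A" using assms(1) by (simp add: hermitian_def)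
  ultimately have "cnj (A $$ (i, j)) = A $$ (j, i)" if "i < n" "j < n" for i j
    using that by metis
  then show ?thesis by (auto simp: hermitian_on_def)
qed

lemma pos_definite_imp_pos_def_on:
  assumes A: "pos_definite A" "A \<in> carrier_mat n n"
  shows "pos_def_on {0..<n} (\<lambda>i j. A $$ (i, j))"
  unfolding pos_def_on_def
proof (intro conjI allI impI)
  show "hermitian_on {0..<n} (\<lambda>i j. A $$ (i, j))"
    using A by (intro hermitian_imp_hermitian_on) (simp_all add: pos_definite_def)
  fix v :: "nat \<Rightarrow> complex" assume v: "\<exists>i\<in>{0..<n}. v i \<noteq> 0"
  have "vec n v \<noteq> 0\<^sub>v n" using v by (auto simp: vec_eq_iff)
  then have "0 < (A *\<^sub>v vec n v) \<bullet>c vec n v"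
    using A by (auto simp: pos_definite_def)
  also have "(A *\<^sub>v vec n v) \<bullet>c vec n v = sesq {0..<n} (\<lambda>i j. A $$ (i, j)) v v"
    using A(2) by (simp add: sesq_def scalar_prod_def sum_distrib_left mult_ac)
  finally show "Re (sesq {0..<n} (\<lambda>i j. A $$ (i, j)) v v) > 0"
    by (simp add: less_complex_def)
qed

text \<open>A scalar matrix is fixed by every sign conjugation, so all summands of the sign average
  are the characteristic determinant itself.\<close>

lemma det_pencil_eq_eta:
  assumes B: "B \<in> carrier_mat n n"
  shows "det (z_times (1\<^sub>m n) - const_mat B) = eta (z_times (1\<^sub>m n)) (- const_mat B)"
proof (rule poly_ext)
  fix w :: complex
  let ?I = "\<lambda>i j. if i = j then w else 0" and ?B = "\<lambda>i j. - B $$ (i, j)"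
  have dim: "z_times (1\<^sub>m n) - const_mat B \<in> carrier_mat n n"
    using B by (intro carrier_matI) (simp_all add: z_times_def const_mat_def)
  have "poly (det (z_times (1\<^sub>m n) - const_mat B)) w =
      poly (fdet n (\<lambda>i j. (z_times (1\<^sub>m n) - const_mat B) $$ (i, j))) w"
    unfolding fdet_def
    by (rule arg_cong[of _ _ "\<lambda>M. poly (det M) w"], rule eq_matI)
      (simp_all add: carrier_matD[OF dim] del: index_minus_mat)
  also have "\<dots> = fdet n (\<lambda>i j. ?I i j + ?B i j)"
    unfolding poly_fdet
    by (rule fdet_cong) (use B in \<open>simp add: z_times_def const_mat_def one_mat_def\<close>)
  also have "\<dots> = (\<Sum>S\<in>Pow {0..<n}. fdet n (block_entry S ?I ?B))"
  proof (rule sum_block_if_flip_invariant[symmetric])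
    fix T show "fdet n (\<lambda>i j. sign_flip T ?I i j + ?B i j) = fdet n (\<lambda>i j. ?I i j + ?B i j)"
      by (rule fdet_cong) (simp add: sign_flip_def sgn_on_def)
  qed
  also have "\<dots> = poly (eta (z_times (1\<^sub>m n)) (- const_mat B)) w"
    unfolding eta_eq_pencil_poly[OF one_carrier_mat B] poly_pencil_poly
    by (intro sum.cong refl fdet_cong) (simp add: block_entry_def)
  finally show "poly (det (z_times (1\<^sub>m n) - const_mat B)) w =
      poly (eta (z_times (1\<^sub>m n)) (- const_mat B)) w" .
qed

theorem mainTheorem3:
  fixes n :: nat and A B :: "complex mat"
  assumes "n \<ge> 1"
    and "A \<in> carrier_mat n n" and "B \<in> carrier_mat n n"
    and "hermitian A" and "hermitian B"
    and "pos_definite A"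
  shows "hyperbolic (eta (z_times A) (- const_mat B)) \<and>
    hyperbolic (eta (z_times (1\<^sub>m n)) (- const_mat B)) \<and>
    hyperbolic (Determinant.det (z_times (1\<^sub>m n) - const_mat B)) \<and>
    iota (eta (z_times A) (- const_mat B)) = iota (eta (z_times (1\<^sub>m n)) (- const_mat B)) \<and>
    iota (eta (z_times (1\<^sub>m n)) (- const_mat B)) =
      iota (Determinant.det (z_times (1\<^sub>m n) - const_mat B))"
proof -
  let ?A = "\<lambda>i j. A $$ (i, j)" and ?B = "\<lambda>i j. B $$ (i, j)"
    and ?I = "\<lambda>i j. 1\<^sub>m n $$ (i, j) :: complex"
  have A: "pos_def_on {0..<n} ?A" by (rule pos_definite_imp_pos_def_on) fact+
  have B: "hermitian_on {0..<n} ?B" by (rule hermitian_imp_hermitian_on) fact+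
  have I: "pos_def_on {0..<n} ?I"
  proof -
    \<comment> \<open>With \<open>S\<close> empty the block matrix is the identity.\<close>
    have "pos_def_on {0..<n} (block_entry {} ?A (\<lambda>i j. if i = j then 1 else 0))"
      by (rule pos_def_on_block_one[OF A]) simp
    then show ?thesis
      by (simp add: pos_def_on_def hermitian_on_def sesq_def block_entry_def)
  qed
  show ?thesis
    unfolding det_pencil_eq_eta[OF assms(3)] eta_eq_pencil_poly[OF assms(2,3)]
      eta_eq_pencil_poly[OF one_carrier_mat assms(3)]
    using hyperbolic_pencil_poly[OF A B] hyperbolic_pencil_poly[OF I B] iota_pencil_poly[OF A I B]
    by simp
qed

end
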